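(* For every $T \in (0,\infty)$ there exist a Gelfand triple $V \hookrightarrow H \hookrightarrow V'$ of complex Hilbert spaces and a symmetric non-autonomous sesquilinear form $a\colon [0,T] \times V \times V \to \mathbb{C}$ such that the following hold. (1) There are constants $\alpha, M > 0$ such that $|a(t,u,v)| \le M \|u\|_V \|v\|_V$ and $\operatorname{Re} a(t,u,u) \ge \alpha \|u\|_V^2$ for all $t \in [0,T]$ and $u,v \in V$. (2) There is a constant $K \ge 0$ such that $$|a(t,u,v) - a(s,u,v)| \le K |t-s|^{1/2} \|u\|_V \|v\|_V \qquad \text{for all } t,s \in [0,T],\ u,v \in V.$$ (3) There is an inhomogeneity $f \in L^2([0,T];V)$ for which the non-autonomous Cauchy problem $$\dot{u}(t) + A(t)u(t) = f(t), \qquad u(0) = 0,$$ where $A(t)$ is the operator on $H$ associated to $a(t,\cdot,\cdot)$, fails to have maximal regularity, i.e. it does not have a unique solution in the maximal regularity space $\mathrm{MR}_2([0,T])$ (equivalently, its unique weak solution in $L^2([0,T];V) \cap H^1([0,T];V')$ does not belong to $\mathrm{MR}_2([0,T])$).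
   Context: All Hilbert spaces are complex; sesquilinear forms are linear in the first and anti-linear in the second component. For a Hilbert space $V$, $V'$ denotes its anti-dual, i.e. the space of continuous anti-linear functionals on $V$. A Gelfand triple $V \hookrightarrow H \hookrightarrow V'$ consists of Hilbert spaces $V, H$ with $V$ continuously and densely embedded in $H$, together with the induced dense embedding $H \hookrightarrow V'$, $h \mapsto [v \mapsto (h|v)_H]$. A non-autonomous sesquilinear form is a map $a\colon [0,T]\times V \times V \to \mathbb{C}$ such that $a(t,\cdot,\cdot)$ is sesquilinear for every $t \in [0,T]$. It is symmetric if $a(t,u,v) = \overline{a(t,v,u)}$ for all $t \in [0,T]$ and $u,v \in V$. The operator $A(t)$ on $H$ associated to $a(t,\cdot,\cdot)$ is defined by $$D(A(t)) = \{u \in V : \exists f \in H \text{ with } a(t,u,v) = (f|v)_H \text{ for all } v \in V\}, \qquad A(t)u = f.$$ The bounded operator $\mathcal{A}(t)\colon V \to V'$ is given by $\langle \mathcal{A}(t)u, v\rangle = a(t,u,v)$. The maximal regularity space is $$\mathrm{MR}_2([0,T]) = \{u \in H^1([0,T];H) : u(t) \in D(A(t)) \text{ for almost all } t \in [0,T] \text{ and } A(\cdot)u(\cdot) \in L^2([0,T];H)\},$$ where $H^1([0,T];X)=W^{1,2}([0,T];X)$ denotes the vector-valued Sobolev space of $X$-valued functions with square-integrable first derivative. The weak solution is the solution of $\dot{u}(t) + \mathcal{A}(t)u(t) = f(t)$, $u(0) = u_0$, in $L^2([0,T];V) \cap H^1([0,T];V')$. By a classical theorem of J.-L. Lions it exists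 and is unique for all $f \in L^2([0,T];V')$ and $u_0 \in H$ whenever $a$ satisfies the uniform boundedness and coercivity estimates in (1) and $a(\cdot,u,v)$ is measurable for all $u,v \in V$. *)

theory Defs
  imports "HOL-Analysis.Analysis"
begin

section \<open>Complex Hilbert spaces\<close>

text \<open>
  The real structure of a complex Hilbert space is the one of \<^class>\<open>real_inner\<close>, so that norms,
  topology and Bochner integrals are those of the library. The complex inner product is linear in
  the first and anti-linear in the second argument.
\<close>

class complex_inner = real_inner +
  fixes scaleC :: "complex \<Rightarrow> 'a \<Rightarrow> 'a" (infixr \<open>*\<^sub>C\<close> 75)
    and cinner :: "'a \<Rightarrow> 'a \<Rightarrow> complex"
  assumes scaleC_add_right: "c *\<^sub>C (x + y) = c *\<^sub>C x + c *\<^sub>C y"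
    and scaleC_add_left: "(c + d) *\<^sub>C x = c *\<^sub>C x + d *\<^sub>C x"
    and scaleC_scaleC: "c *\<^sub>C d *\<^sub>C x = (c * d) *\<^sub>C x"
    and scaleR_scaleC: "scaleR r x = complex_of_real r *\<^sub>C x"
    and cinner_add_left: "cinner (x + y) z = cinner x z + cinner y z"
    and cinner_scaleC_left: "cinner (c *\<^sub>C x) y = c * cinner x y"
    and cinner_commute: "cinner x y = cnj (cinner y x)"
    and inner_eq_Re_cinner: "inner x y = Re (cinner x y)"

class complex_hilbert_space = complex_inner + banach


section \<open>The sequence space of square-summable complex sequences\<close>

text \<open>
  An existential quantifier cannot range over types. Up to unitary equivalence this type is the
  only separable infinite-dimensional complex Hilbert space; an assertion that
  separable infinite-dimensional Hilbert spaces with some property exist is therefore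
  stated for it.
\<close>

typedef ell2 = "{x :: nat \<Rightarrow> complex. summable (\<lambda>n. (cmod (x n))\<^sup>2)}"
  by (rule exI[of _ "\<lambda>_. 0"]) simp

setup_lifting type_definition_ell2

lemma ell2_summable_mult:
  fixes x y :: "nat \<Rightarrow> complex"
  assumes "summable (\<lambda>n. (cmod (x n))\<^sup>2)" "summable (\<lambda>n. (cmod (y n))\<^sup>2)"
  shows "summable (\<lambda>n. x n * cnj (y n))"
proof (rule summable_comparison_test')
  show "summable (\<lambda>n. (cmod (x n))\<^sup>2 + (cmod (y n))\<^sup>2)"
    using assms by (rule summable_add)
  fix n
  have "2 * (cmod (x n) * cmod (y n)) \<le> (cmod (x n))\<^sup>2 + (cmod (y n))\<^sup>2"
    using sum_squares_bound[of "cmod (x n)" "cmod (y n)"] by simp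
  moreover have "0 \<le> cmod (x n) * cmod (y n)" by simp
  ultimately show "norm (x n * cnj (y n)) \<le> (cmod (x n))\<^sup>2 + (cmod (y n))\<^sup>2"
    unfolding norm_mult complex_mod_cnj by linarith
qed

lemma ell2_summable_add:
  fixes x y :: "nat \<Rightarrow> complex"
  assumes "summable (\<lambda>n. (cmod (x n))\<^sup>2)" "summable (\<lambda>n. (cmod (y n))\<^sup>2)"
  shows "summable (\<lambda>n. (cmod (x n + y n))\<^sup>2)"
proof (rule summable_comparison_test')
  show "summable (\<lambda>n. 2 * (cmod (x n))\<^sup>2 + 2 * (cmod (y n))\<^sup>2)"
    using assms by (intro summable_add summable_mult)
  fix n
  have "(cmod (x n + y n))\<^sup>2 \<le> (cmod (x n) + cmod (y n))\<^sup>2"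
    by (intro power_mono norm_triangle_ineq norm_ge_zero)
  also have "\<dots> \<le> 2 * (cmod (x n))\<^sup>2 + 2 * (cmod (y n))\<^sup>2"
    using sum_squares_bound[of "cmod (x n)" "cmod (y n)"] by (simp add: power2_sum)
  finally show "norm ((cmod (x n + y n))\<^sup>2) \<le> 2 * (cmod (x n))\<^sup>2 + 2 * (cmod (y n))\<^sup>2"
    by simp
qed

lemma ell2_summable_scale:
  fixes x :: "nat \<Rightarrow> complex"
  assumes "summable (\<lambda>n. (cmod (x n))\<^sup>2)"
  shows "summable (\<lambda>n. (cmod (c * x n))\<^sup>2)"
  using summable_mult[OF assms, of "(cmod c)\<^sup>2"] by (simp add: norm_mult power_mult_distrib)

lemma ell2_suminf_self:
  fixes x :: "nat \<Rightarrow> complex"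
  assumes "summable (\<lambda>n. (cmod (x n))\<^sup>2)"
  shows "Re (\<Sum>n. x n * cnj (x n)) = (\<Sum>n. (cmod (x n))\<^sup>2)"
proof -
  have "(\<lambda>n. x n * cnj (x n)) = (\<lambda>n. complex_of_real ((cmod (x n))\<^sup>2))"
    by (rule ext) (simp only: complex_norm_square)
  then show ?thesis using suminf_of_real[OF assms, where 'a = complex] by (metis Re_complex_of_real)
qed

instantiation ell2 :: complex_inner
begin

lift_definition zero_ell2 :: ell2 is "\<lambda>_. 0" by simp
lift_definition plus_ell2 :: "ell2 \<Rightarrow> ell2 \<Rightarrow> ell2" is "\<lambda>x y n. x n + y n"
  by (rule ell2_summable_add)
lift_definition uminus_ell2 :: "ell2 \<Rightarrow> ell2" is "\<lambda>x n. - x n" by simp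
lift_definition minus_ell2 :: "ell2 \<Rightarrow> ell2 \<Rightarrow> ell2" is "\<lambda>x y n. x n - y n"
  using ell2_summable_add[of _ "\<lambda>n. - _ n"] by simp
lift_definition scaleC_ell2 :: "complex \<Rightarrow> ell2 \<Rightarrow> ell2" is "\<lambda>c x n. c * x n"
  by (rule ell2_summable_scale)
lift_definition cinner_ell2 :: "ell2 \<Rightarrow> ell2 \<Rightarrow> complex" is "\<lambda>x y. \<Sum>n. x n * cnj (y n)" .

definition scaleR_ell2 :: "real \<Rightarrow> ell2 \<Rightarrow> ell2" where
  "scaleR_ell2 r x = complex_of_real r *\<^sub>C x"
definition inner_ell2 :: "ell2 \<Rightarrow> ell2 \<Rightarrow> real" where
  "inner_ell2 x y = Re (cinner x y)"
definition norm_ell2 :: "ell2 \<Rightarrow> real" where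
  "norm_ell2 x = sqrt (inner x x)"
definition sgn_ell2 :: "ell2 \<Rightarrow> ell2" where
  "sgn_ell2 x = scaleR (inverse (norm x)) x"
definition dist_ell2 :: "ell2 \<Rightarrow> ell2 \<Rightarrow> real" where
  "dist_ell2 x y = norm (x - y)"
definition uniformity_ell2 :: "(ell2 \<times> ell2) filter" where
  "uniformity_ell2 = (INF e\<in>{0<..}. principal {(x, y). dist x y < e})"
definition open_ell2 :: "ell2 set \<Rightarrow> bool" where
  "open_ell2 U \<longleftrightarrow> (\<forall>x\<in>U. \<forall>\<^sub>F (x', y) in uniformity. x' = x \<longrightarrow> y \<in> U)"

instance
proof
  fix x y z :: ell2 and c d :: complex and r s :: real and U :: "ell2 set"
  show "x + y + z = x + (y + z)" by transfer (simp add: add.assoc)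
  show "x + y = y + x" by transfer (simp add: add.commute)
  show "0 + x = x" by transfer simp
  show "- x + x = 0" by transfer simp
  show "x - y = x + - y" by transfer simp
  show s1: "c *\<^sub>C (x + y) = c *\<^sub>C x + c *\<^sub>C y"
    and s2: "(c + d) *\<^sub>C x = c *\<^sub>C x + d *\<^sub>C x"
    and s3: "c *\<^sub>C d *\<^sub>C x = (c * d) *\<^sub>C x"
    by (transfer, simp add: algebra_simps)+
  show "r *\<^sub>R x = complex_of_real r *\<^sub>C x" by (rule scaleR_ell2_def)
  have s4: "1 *\<^sub>C x = x" by transfer simp
  show "r *\<^sub>R (x + y) = r *\<^sub>R x + r *\<^sub>R y" "(r + s) *\<^sub>R x = r *\<^sub>R x + s *\<^sub>R x"
    "r *\<^sub>R s *\<^sub>R x = (r * s) *\<^sub>R x" "1 *\<^sub>R x = x"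
    unfolding scaleR_ell2_def by (transfer, simp add: algebra_simps)+
  show ca: "cinner (x + y) z = cinner x z + cinner y z" for x y z :: ell2
    by transfer (simp add: distrib_right suminf_add ell2_summable_mult)
  show cs: "cinner (c *\<^sub>C x) y = c * cinner x y" for c and x y :: ell2
    by transfer (simp add: mult.assoc suminf_mult ell2_summable_mult)
  show cc: "cinner x y = cnj (cinner y x)" for x y :: ell2
  proof transfer
    fix x y :: "nat \<Rightarrow> complex"
    assume "summable (\<lambda>n. (cmod (x n))\<^sup>2)" "summable (\<lambda>n. (cmod (y n))\<^sup>2)"
    then have "(\<lambda>n. y n * cnj (x n)) sums (\<Sum>n. y n * cnj (x n))"
      by (intro summable_sums ell2_summable_mult)
    then have "(\<lambda>n. cnj (y n * cnj (x n))) sums cnj (\<Sum>n. y n * cnj (x n))"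
      by (simp only: sums_cnj)
    then show "(\<Sum>n. x n * cnj (y n)) = cnj (\<Sum>n. y n * cnj (x n))"
      by (simp add: sums_iff mult.commute)
  qed
  show "inner x y = Re (cinner x y)" by (rule inner_ell2_def)
  show "inner x y = inner y x"
    unfolding inner_ell2_def by (subst cc) simp
  show "inner (x + y) z = inner x z + inner y z" unfolding inner_ell2_def ca by simp
  show "inner (r *\<^sub>R x) y = r * inner x y" unfolding inner_ell2_def scaleR_ell2_def cs by simp
  have sq: "inner x x = (\<Sum>n. (cmod (Rep_ell2 x n))\<^sup>2)"
    unfolding inner_ell2_def
    by transfer (rule ell2_suminf_self)
  have sm: "summable (\<lambda>n. (cmod (Rep_ell2 x n))\<^sup>2)" using Rep_ell2[of x] by simp
  show "0 \<le> inner x x" unfolding sq by (intro suminf_nonneg sm) simp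
  show "inner x x = 0 \<longleftrightarrow> x = 0"
    unfolding sq using suminf_eq_zero_iff[OF sm]
    by (simp add: Rep_ell2_inject[symmetric] zero_ell2.rep_eq fun_eq_iff)
  show "norm x = sqrt (inner x x)" by (rule norm_ell2_def)
  show "sgn x = scaleR (inverse (norm x)) x" by (rule sgn_ell2_def)
  show "dist x y = norm (x - y)" by (rule dist_ell2_def)
  show "uniformity = (INF e\<in>{0<..}. principal {(x :: ell2, y). dist x y < e})"
    by (rule uniformity_ell2_def)
  show "open U \<longleftrightarrow> (\<forall>x\<in>U. \<forall>\<^sub>F (x', y) in uniformity. x' = x \<longrightarrow> y \<in> U)"
    by (rule open_ell2_def)
qed

end

lemma norm_ell2_sq: "(norm x)\<^sup>2 = (\<Sum>n. (cmod (Rep_ell2 x n))\<^sup>2)"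
  unfolding power2_norm_eq_inner[of x] inner_eq_Re_cinner[of x]
  by transfer (rule ell2_suminf_self)

lemma ell2_summable: "summable (\<lambda>n. (cmod (Rep_ell2 x n))\<^sup>2)"
  using Rep_ell2[of x] by simp

lemma ell2_sum_le: "finite F \<Longrightarrow> (\<Sum>n\<in>F. (cmod (Rep_ell2 x n))\<^sup>2) \<le> (norm x)\<^sup>2"
  unfolding norm_ell2_sq by (intro sum_le_suminf ell2_summable) auto

lemma ell2_component_le: "cmod (Rep_ell2 x n) \<le> norm x"
  using ell2_sum_le[of "{n}" x] by (simp add: abs_le_square_iff[symmetric])

instance ell2 :: complex_hilbert_space
proof
  fix X :: "nat \<Rightarrow> ell2"
  assume X: "Cauchy X"
  have "convergent (\<lambda>k. Rep_ell2 (X k) n)" for n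
  proof (intro Cauchy_convergent CauchyI)
    fix e :: real assume "0 < e"
    with X obtain N where N: "\<And>m k. m \<ge> N \<Longrightarrow> k \<ge> N \<Longrightarrow> norm (X m - X k) < e"
      by (meson CauchyD)
    have "norm (Rep_ell2 (X m) n - Rep_ell2 (X k) n) \<le> norm (X m - X k)" for m k
      using ell2_component_le[of "X m - X k" n] by (simp add: minus_ell2.rep_eq)
    with N show "\<exists>N. \<forall>m\<ge>N. \<forall>k\<ge>N. norm (Rep_ell2 (X m) n - Rep_ell2 (X k) n) < e"
      by (meson le_less_trans)
  qed
  then obtain x where x: "\<And>n. (\<lambda>k. Rep_ell2 (X k) n) \<longlonglongrightarrow> x n"
    unfolding convergent_def by metis
  have tail: "summable (\<lambda>n. (cmod (Rep_ell2 (X m) n - x n))\<^sup>2) \<and>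
      (\<Sum>n. (cmod (Rep_ell2 (X m) n - x n))\<^sup>2) \<le> e\<^sup>2"
    if N: "\<And>k. k \<ge> N \<Longrightarrow> norm (X m - X k) \<le> e" for m N e
  proof -
    have le: "(\<Sum>n<F. (cmod (Rep_ell2 (X m) n - x n))\<^sup>2) \<le> e\<^sup>2" for F :: nat
    proof (rule tendsto_upperbound)
      show "(\<lambda>k. \<Sum>n<F. (cmod (Rep_ell2 (X m) n - Rep_ell2 (X k) n))\<^sup>2)
          \<longlonglongrightarrow> (\<Sum>n<F. (cmod (Rep_ell2 (X m) n - x n))\<^sup>2)"
        by (intro tendsto_intros x)
      show "\<forall>\<^sub>F k in sequentially.
          (\<Sum>n<F. (cmod (Rep_ell2 (X m) n - Rep_ell2 (X k) n))\<^sup>2) \<le> e\<^sup>2"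
      proof (rule eventually_sequentiallyI[of N])
        fix k assume "N \<le> k"
        then have "(norm (X m - X k))\<^sup>2 \<le> e\<^sup>2" using N by (intro power_mono) auto
        with ell2_sum_le[of "{..<F}" "X m - X k"]
        show "(\<Sum>n<F. (cmod (Rep_ell2 (X m) n - Rep_ell2 (X k) n))\<^sup>2) \<le> e\<^sup>2"
          by (simp add: minus_ell2.rep_eq)
      qed
    qed simp
    have "summable (\<lambda>n. (cmod (Rep_ell2 (X m) n - x n))\<^sup>2)"
      by (rule summableI_nonneg_bounded[where x = "e\<^sup>2"]) (use le in auto)
    moreover from this have "(\<Sum>n. (cmod (Rep_ell2 (X m) n - x n))\<^sup>2) \<le> e\<^sup>2"
      by (intro suminf_le_const le)
    ultimately show ?thesis by simp
  qed
  obtain N1 where N1: "\<And>k. k \<ge> N1 \<Longrightarrow> norm (X N1 - X k) \<le> 1"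
    using CauchyD[OF X, of 1] by (metis less_imp_le order_refl zero_less_one)
  have "summable (\<lambda>n. (cmod (Rep_ell2 (X N1) n + - 1 * (Rep_ell2 (X N1) n - x n)))\<^sup>2)"
    using tail[OF N1] by (intro ell2_summable_add ell2_summable_scale ell2_summable) simp
  then have "summable (\<lambda>n. (cmod (x n))\<^sup>2)" by simp
  then have Rep: "Rep_ell2 (Abs_ell2 x) = x" by (simp add: Abs_ell2_inverse)
  have "X \<longlonglongrightarrow> Abs_ell2 x"
  proof (rule LIMSEQ_I)
    fix e :: real assume e: "0 < e"
    obtain N where N: "\<And>m k. m \<ge> N \<Longrightarrow> k \<ge> N \<Longrightarrow> norm (X m - X k) < e / 2"
      using CauchyD[OF X, of "e / 2"] e by auto
    have "norm (X m - Abs_ell2 x) < e" if "m \<ge> N" for m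
    proof -
      have "(norm (X m - Abs_ell2 x))\<^sup>2 \<le> (e / 2)\<^sup>2"
        using tail[of N m "e / 2"] N[OF that] unfolding norm_ell2_sq
        by (simp add: minus_ell2.rep_eq Rep less_imp_le)
      then have "norm (X m - Abs_ell2 x) \<le> e / 2" by (rule power2_le_imp_le) (use e in simp)
      then show ?thesis using e by simp
    qed
    then show "\<exists>no. \<forall>n\<ge>no. norm (X n - Abs_ell2 x) < e" by blast
  qed
  then show "convergent X" by (rule convergentI)
qed

lemma ell2_dense:
  fixes x :: ell2
  assumes "0 < e"
  obtains qs :: "(rat \<times> rat) list" where
    "norm (x - Abs_ell2 (\<lambda>n. if n < length qs
       then Complex (of_rat (fst (qs ! n))) (of_rat (snd (qs ! n))) else 0)) < e"
proof -
  define f where "f = (\<lambda>n. (cmod (Rep_ell2 x n))\<^sup>2)"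
  have f: "summable f" "\<And>n. 0 \<le> f n" unfolding f_def using ell2_summable by auto
  obtain N where N: "norm (\<Sum>n. f (n + N)) < e\<^sup>2 / 2"
    using suminf_exist_split[of "e\<^sup>2 / 2", OF _ f(1)] assms by (auto simp: add.commute)
  define d where "d = e / (2 * (real N + 1))"
  have d: "0 < d" using assms by (simp add: d_def)
  have "\<exists>q :: rat \<times> rat. cmod (z - Complex (of_rat (fst q)) (of_rat (snd q))) < d" for z
  proof -
    obtain a where a: "Re z < of_rat a" "of_rat a < Re z + d / 2"
      using of_rat_dense[of "Re z" "Re z + d / 2"] d by auto
    obtain b where b: "Im z < of_rat b" "of_rat b < Im z + d / 2"
      using of_rat_dense[of "Im z" "Im z + d / 2"] d by auto
    have "cmod (z - Complex (of_rat a) (of_rat b)) \<le> \<bar>Re z - of_rat a\<bar> + \<bar>Im z - of_rat b\<bar>"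
      using cmod_le[of "z - Complex (of_rat a) (of_rat b)"] by simp
    also have "\<dots> < d" using a b by simp
    finally show ?thesis by (intro exI[of _ "(a, b)"]) simp
  qed
  then obtain q :: "complex \<Rightarrow> rat \<times> rat" where
    q: "\<And>z. cmod (z - Complex (of_rat (fst (q z))) (of_rat (snd (q z)))) < d" by metis
  define qs where "qs = map (\<lambda>n. q (Rep_ell2 x n)) [0..<N]"
  define y where "y = (\<lambda>n. if n < length qs
       then Complex (of_rat (fst (qs ! n))) (of_rat (snd (qs ! n))) else 0)"
  have "summable (\<lambda>n. (cmod (y n))\<^sup>2)"
    by (rule summable_finite[of "{..<length qs}"]) (auto simp: y_def)
  then have Rep: "Rep_ell2 (Abs_ell2 y) = y" by (simp add: Abs_ell2_inverse)
  define g where "g = (\<lambda>n. (cmod (Rep_ell2 x n - y n))\<^sup>2)"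
  have g: "summable g"
    using ell2_summable[of "x - Abs_ell2 y"] by (simp add: g_def minus_ell2.rep_eq Rep)
  have g1: "g n \<le> d\<^sup>2" if "n < N" for n
  proof -
    have "y n = Complex (of_rat (fst (q (Rep_ell2 x n)))) (of_rat (snd (q (Rep_ell2 x n))))"
      using that by (simp add: y_def qs_def)
    then have "cmod (Rep_ell2 x n - y n) \<le> d" using q[of "Rep_ell2 x n"] by simp
    then show ?thesis unfolding g_def by (intro power_mono) auto
  qed
  have g2: "g (n + N) = f (n + N)" for n by (simp add: g_def f_def y_def qs_def)
  have "(norm (x - Abs_ell2 y))\<^sup>2 = (\<Sum>n. g n)"
    by (simp add: norm_ell2_sq g_def minus_ell2.rep_eq Rep)
  also have "\<dots> = (\<Sum>n. g (n + N)) + (\<Sum>n<N. g n)" by (rule suminf_split_initial_segment[OF g])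
  also have "(\<Sum>n. g (n + N)) < e\<^sup>2 / 2" unfolding g2 using N by simp
  also have "(\<Sum>n<N. g n) \<le> (\<Sum>n<N. d\<^sup>2)" by (intro sum_mono g1) simp
  also have "(\<Sum>n<N. d\<^sup>2) = real N * d\<^sup>2" by simp
  also have "real N * d\<^sup>2 \<le> e\<^sup>2 / 2"
  proof -
    have "2 * real N \<le> (2 * (real N + 1))\<^sup>2" by (simp add: power2_eq_square algebra_simps)
    then have "real N / (2 * (real N + 1))\<^sup>2 \<le> 1 / 2" by (simp add: divide_simps)
    from mult_left_mono[OF this, of "e\<^sup>2"] show ?thesis
      by (simp add: d_def power_divide mult.commute)
  qed
  finally have "(norm (x - Abs_ell2 y))\<^sup>2 < e\<^sup>2" by simp
  then have "norm (x - Abs_ell2 y) < e" by (rule power2_less_imp_less) (use assms in simp)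
  then show thesis using that[of qs] by (simp add: y_def)
qed

instance ell2 :: second_countable_topology
proof
  define D where "D = range (\<lambda>qs :: (rat \<times> rat) list. Abs_ell2 (\<lambda>n. if n < length qs
       then Complex (of_rat (fst (qs ! n))) (of_rat (snd (qs ! n))) else 0))"
  define B where "B = (\<lambda>(d, n). ball d (inverse (real (Suc n)))) ` (D \<times> (UNIV :: nat set))"
  have "countable D" unfolding D_def by simp
  then have "countable B" unfolding B_def by (intro countable_image countable_SIGMA) auto
  moreover have "topological_basis B"
  proof (rule topological_basisI)
    show "open V" if "V \<in> B" for V using that by (auto simp: B_def)
    fix U and x :: ell2 assume "open U" "x \<in> U"
    then obtain e where e: "0 < e" "ball x e \<subseteq> U" by (auto simp: open_contains_ball)
    obtain n where n: "inverse (real (Suc n)) < e / 2"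
      using reals_Archimedean[of "e / 2"] e by auto
    obtain d where d: "d \<in> D" "norm (x - d) < inverse (real (Suc n))"
    proof (rule ell2_dense[of "inverse (real (Suc n))" x])
      fix qs :: "(rat \<times> rat) list"
      assume "norm (x - Abs_ell2 (\<lambda>n. if n < length qs
        then Complex (of_rat (fst (qs ! n))) (of_rat (snd (qs ! n))) else 0)) < inverse (real (Suc n))"
      then show thesis by (rule that[rotated]) (simp add: D_def)
    qed simp
    have "ball d (inverse (real (Suc n))) \<subseteq> ball x e"
    proof
      fix y assume "y \<in> ball d (inverse (real (Suc n)))"
      then have "dist x y < inverse (real (Suc n)) + inverse (real (Suc n))"
        using d(2) dist_triangle[of x y d] by (simp add: dist_norm)
      then show "y \<in> ball x e" using n by simp
    qed
    moreover have "x \<in> ball d (inverse (real (Suc n)))"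
      using d(2) by (simp add: dist_norm norm_minus_commute)
    moreover have "ball d (inverse (real (Suc n))) \<in> B" using d(1) by (force simp: B_def)
    ultimately show "\<exists>V\<in>B. x \<in> V \<and> V \<subseteq> U" using e(2) by blast
  qed
  ultimately show "\<exists>B :: ell2 set set. countable B \<and> open = generate_topology B"
    using topological_basis_imp_subbasis by blast
qed


section \<open>Forms and associated operators\<close>

text \<open>
  A Gelfand triple is given by the embedding \<open>j\<close> of \<open>V\<close> into \<open>H\<close>; the embedding of \<open>H\<close> into the
  anti-dual of \<open>V\<close> is the one induced by \<open>j\<close>, namely \<open>h \<mapsto> (v \<mapsto> cinner h (j v))\<close>.
\<close>

definition gelfand_triple ::
    "('v::complex_hilbert_space \<Rightarrow> 'h::complex_hilbert_space) \<Rightarrow> bool" where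
  "gelfand_triple j \<longleftrightarrow>
     bounded_linear j \<and> (\<forall>c v. j (c *\<^sub>C v) = c *\<^sub>C j v) \<and> inj j \<and> closure (range j) = UNIV"

definition sesquilinear :: "('v::complex_inner \<Rightarrow> 'v \<Rightarrow> complex) \<Rightarrow> bool" where
  "sesquilinear b \<longleftrightarrow>
     (\<forall>u1 u2 v. b (u1 + u2) v = b u1 v + b u2 v) \<and> (\<forall>c u v. b (c *\<^sub>C u) v = c * b u v) \<and>
     (\<forall>u v1 v2. b u (v1 + v2) = b u v1 + b u v2) \<and> (\<forall>c u v. b u (c *\<^sub>C v) = cnj c * b u v)"

definition nonautonomous_form :: "real \<Rightarrow> (real \<Rightarrow> 'v::complex_inner \<Rightarrow> 'v \<Rightarrow> complex) \<Rightarrow> bool" where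
  "nonautonomous_form T a \<longleftrightarrow> (\<forall>t\<in>{0..T}. sesquilinear (a t))"

definition symmetric_form :: "real \<Rightarrow> (real \<Rightarrow> 'v::complex_inner \<Rightarrow> 'v \<Rightarrow> complex) \<Rightarrow> bool" where
  "symmetric_form T a \<longleftrightarrow> (\<forall>t\<in>{0..T}. \<forall>u v. a t u v = cnj (a t v u))"

definition form_dom ::
    "('v::complex_hilbert_space \<Rightarrow> 'h::complex_hilbert_space) \<Rightarrow> ('v \<Rightarrow> 'v \<Rightarrow> complex) \<Rightarrow> 'h set" where
  "form_dom j b = {j u | u. \<exists>f. \<forall>v. b u v = cinner f (j v)}"

text \<open>
  Meaningful on \<^term>\<open>form_dom j b\<close> only; there \<open>f\<close> is unique if \<open>j\<close> is injective with dense range.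
\<close>

definition form_op ::
    "('v::complex_hilbert_space \<Rightarrow> 'h::complex_hilbert_space) \<Rightarrow> ('v \<Rightarrow> 'v \<Rightarrow> complex) \<Rightarrow> 'h \<Rightarrow> 'h" where
  "form_op j b x = (THE f. \<exists>u. x = j u \<and> (\<forall>v. b u v = cinner f (j v)))"


section \<open>Vector-valued Lebesgue and Sobolev spaces\<close>

text \<open>
  The spaces consist of representatives; functions that agree almost everywhere on \<open>[0,T]\<close> are to
  be identified. Over a second countable space Borel measurability is strong measurability.
\<close>

definition L2 :: "real \<Rightarrow> (real \<Rightarrow> 'a::{banach, second_countable_topology}) set" where
  "L2 T = {f. f \<in> borel_measurable (lebesgue_on {0..T}) \<and>
              integrable (lebesgue_on {0..T}) (\<lambda>t. (norm (f t))\<^sup>2)}"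

definition test_functions :: "real \<Rightarrow> (real \<Rightarrow> real) set" where
  "test_functions T = {\<phi>. (\<forall>n. (deriv ^^ n) \<phi> differentiable_on UNIV) \<and>
     compact (closure {t. \<phi> t \<noteq> 0}) \<and> closure {t. \<phi> t \<noteq> 0} \<subseteq> {0<..<T}}"

definition weak_deriv ::
    "real \<Rightarrow> (real \<Rightarrow> 'a::{banach, second_countable_topology}) \<Rightarrow> (real \<Rightarrow> 'a) \<Rightarrow> bool" where
  "weak_deriv T u u' \<longleftrightarrow> (\<forall>\<phi>\<in>test_functions T.
     (\<integral>t. deriv \<phi> t *\<^sub>R u t \<partial>lebesgue_on {0..T}) = - (\<integral>t. \<phi> t *\<^sub>R u' t \<partial>lebesgue_on {0..T}))"

definition H1 :: "real \<Rightarrow> (real \<Rightarrow> 'a::{banach, second_countable_topology}) set" where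
  "H1 T = {u \<in> L2 T. \<exists>u'\<in>L2 T. weak_deriv T u u'}"

text \<open>Pointwise values of a Sobolev function are those of its continuous representative.\<close>

definition initial_value ::
    "real \<Rightarrow> (real \<Rightarrow> 'a::{banach, second_countable_topology}) \<Rightarrow> 'a \<Rightarrow> bool" where
  "initial_value T u x \<longleftrightarrow>
     (\<exists>w. continuous_on {0..T} w \<and> (AE t in lebesgue_on {0..T}. w t = u t) \<and> w 0 = x)"


section \<open>Maximal regularity\<close>

definition MR2 :: "real \<Rightarrow>
    ('v::complex_hilbert_space \<Rightarrow> 'h::{complex_hilbert_space, second_countable_topology}) \<Rightarrow>
    (real \<Rightarrow> 'v \<Rightarrow> 'v \<Rightarrow> complex) \<Rightarrow> (real \<Rightarrow> 'h) set" where
  "MR2 T j a = {u \<in> H1 T. (AE t in lebesgue_on {0..T}. u t \<in> form_dom j (a t)) \<and>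
     (\<lambda>t. form_op j (a t) (u t)) \<in> L2 T}"

definition MR2_solution :: "real \<Rightarrow>
    ('v::complex_hilbert_space \<Rightarrow> 'h::{complex_hilbert_space, second_countable_topology}) \<Rightarrow>
    (real \<Rightarrow> 'v \<Rightarrow> 'v \<Rightarrow> complex) \<Rightarrow> (real \<Rightarrow> 'h) \<Rightarrow> 'h \<Rightarrow> (real \<Rightarrow> 'h) \<Rightarrow> bool" where
  "MR2_solution T j a f u0 u \<longleftrightarrow> u \<in> MR2 T j a \<and>
     (\<exists>u'\<in>L2 T. weak_deriv T u u' \<and>
        (AE t in lebesgue_on {0..T}. u' t + form_op j (a t) (u t) = f t)) \<and>
     initial_value T u u0"

definition maximal_regularity :: "real \<Rightarrow>
    ('v::complex_hilbert_space \<Rightarrow> 'h::{complex_hilbert_space, second_countable_topology}) \<Rightarrow>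
    (real \<Rightarrow> 'v \<Rightarrow> 'v \<Rightarrow> complex) \<Rightarrow> (real \<Rightarrow> 'h) \<Rightarrow> 'h \<Rightarrow> bool" where
  "maximal_regularity T j a f u0 \<longleftrightarrow>
     (\<exists>u. MR2_solution T j a f u0 u \<and>
        (\<forall>w. MR2_solution T j a f u0 w \<longrightarrow> (AE t in lebesgue_on {0..T}. w t = u t)))"

end

theory Submission
  imports Defs
begin

text \<open>
  Let \<open>V\<close> be the weighted space in which the \<open>n\<close>-th unit vector of \<open>H\<close> has norm \<open>2 ^ (n/2)\<close>, and
  couple the zeroth coordinate of the identity form on \<open>V\<close> to all others by an oscillation of
  frequency \<open>2 ^ n\<close> and amplitude of order \<open>2 ^ (-n/2)\<close> in the \<open>n\<close>-th one. This amplitude is just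
  small enough for the coupling vector to be Hoelder continuous of exponent \<open>1/2\<close>. For the
  forcing chosen below the coordinates of the solution are \<open>t\<close> and \<open>t / 8 * 2 ^ (-n) * cis (2 ^ n * t)\<close>
  for \<open>n > 0\<close>, and the \<open>n\<close>-th coordinate of its derivative has modulus at least \<open>t / 8\<close>, so that the
  derivative lies in \<open>H\<close> for no \<open>t > 0\<close>.

  Every solution in the maximal regularity space has these coordinates: they solve scalar linear
  equations, and the difference to the explicit solution vanishes by a supremum estimate, because
  each coordinate is controlled by the zeroth one with a factor \<open>2 ^ (-n)\<close> and the zeroth one by the
  others with a factor whose product with the former is smaller than \<open>1\<close>.
\<close>

section \<open>Smooth step functions\<close>

text \<open>The witness is a whole sequence of successive derivatives, so that closure properties
  follow by operating on sequences instead of on iterates of \<open>deriv\<close>.\<close>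

definition smooth :: "(real \<Rightarrow> real) \<Rightarrow> bool" where
  "smooth f \<longleftrightarrow> (\<exists>F. F 0 = f \<and> (\<forall>n x. (F n has_real_derivative F (Suc n) x) (at x)))"

text \<open>Iterating a choice of derivative that stays inside \<open>S\<close> produces the
  required sequence. No formula for the higher derivatives is needed, only a family closed under
  differentiation.\<close>

lemma smooth_coinduct:
  assumes "f \<in> S" and step: "\<And>g. g \<in> S \<Longrightarrow> \<exists>g'\<in>S. \<forall>x. (g has_real_derivative g' x) (at x)"
  shows "smooth f"
proof -
  obtain d where d: "\<And>g. g \<in> S \<Longrightarrow> d g \<in> S \<and> (\<forall>x. (g has_real_derivative d g x) (at x))"
    using step by metis
  have "(d ^^ n) f \<in> S" for n
    by (induction n) (use assms(1) d in auto)
  with d show ?thesis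
    unfolding smooth_def by (intro exI[of _ "\<lambda>n. (d ^^ n) f"]) auto
qed

lemma smooth_antiderivative:
  assumes "smooth g" "\<And>x. (f has_real_derivative g x) (at x)"
  shows "smooth f"
proof -
  obtain G where G: "G 0 = g" "\<And>n x. (G n has_real_derivative G (Suc n) x) (at x)"
    using assms(1) unfolding smooth_def by blast
  have "((case_nat f G) n has_real_derivative (case_nat f G) (Suc n) x) (at x)" for n x
    using assms(2) G by (cases n) auto
  then show ?thesis unfolding smooth_def by (intro exI[of _ "case_nat f G"]) simp
qed

lemma smooth_diff:
  assumes "smooth f" "smooth g"
  shows "smooth (\<lambda>x. f x - g x)"
proof -
  obtain F G where "F 0 = f" "\<And>n x. (F n has_real_derivative F (Suc n) x) (at x)"
    "G 0 = g" "\<And>n x. (G n has_real_derivative G (Suc n) x) (at x)"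
    using assms unfolding smooth_def by metis
  then show ?thesis
    unfolding smooth_def
    by (intro exI[of _ "\<lambda>n x. F n x - G n x"]) (auto intro!: derivative_intros)
qed

lemma smooth_affine:
  assumes "smooth f"
  shows "smooth (\<lambda>x. f (c * (x - a)))"
proof -
  obtain F where F: "F 0 = f" "\<And>n x. (F n has_real_derivative F (Suc n) x) (at x)"
    using assms unfolding smooth_def by metis
  have "((\<lambda>x. c ^ n * F n (c * (x - a))) has_real_derivative c ^ Suc n * F (Suc n) (c * (x - a))) (at x)"
    for n x
    by (rule derivative_eq_intros DERIV_chain'[OF _ F(2)] refl)+ (simp add: mult_ac)
  then show ?thesis
    unfolding smooth_def by (intro exI[of _ "\<lambda>n x. c ^ n * F n (c * (x - a))"]) (simp add: F)
qed

lemma smooth_mult_left: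
  assumes "smooth f"
  shows "smooth (\<lambda>x. c * f x)"
proof -
  obtain F where F: "F 0 = f" "\<And>n x. (F n has_real_derivative F (Suc n) x) (at x)"
    using assms unfolding smooth_def by metis
  then show ?thesis
    unfolding smooth_def
    by (intro exI[of _ "\<lambda>n x. c * F n x"]) (auto intro!: DERIV_cmult)
qed

lemma smooth_imp_deriv_differentiable:
  assumes "smooth f"
  shows "(deriv ^^ n) f differentiable_on UNIV"
proof -
  obtain F where F: "F 0 = f" "\<And>n x. (F n has_real_derivative F (Suc n) x) (at x)"
    using assms unfolding smooth_def by metis
  have "(deriv ^^ n) f = F n" for n
    by (induction n) (auto simp: F(1) intro!: ext DERIV_imp_deriv F(2))
  then show ?thesis
    by (auto simp: differentiable_on_def real_differentiable_def intro: F(2))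
qed

lemma smooth_continuous: "smooth f \<Longrightarrow> continuous_on S f"
  using differentiable_imp_continuous_on[OF smooth_imp_deriv_differentiable[of f 0]]
  by (auto intro: continuous_on_subset)

section \<open>Functions on the unit interval that are flat at both ends\<close>

lemma exp_minus_inverse_le:
  fixes q :: real
  assumes "0 < q"
  shows "exp (- inverse q) \<le> fact k * q ^ k"
proof -
  \<comment> \<open>Only the term of index \<open>k\<close> of the exponential series is
    kept.\<close>
  have "(\<Sum>n\<in>{k}. inverse q ^ n /\<^sub>R fact n) \<le> exp (inverse q)"
    unfolding exp_def using assms by (intro sum_le_suminf summable_exp_generic) auto
  then show ?thesis
    using assms by (simp add: exp_minus field_simps)
qed

text \<open>
  This family, unlike the single function with \<open>p = 1\<close> and \<open>m = 0\<close>, is closed under differentiation.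
\<close>

definition bump :: "real poly \<Rightarrow> nat \<Rightarrow> real \<Rightarrow> real" where
  "bump p m x = (if 0 < x \<and> x < 1
     then poly p x * inverse (x * (1 - x)) ^ m * exp (- inverse (x * (1 - x))) else 0)"

text \<open>For \<open>x\<close> in the open unit interval, x (1 - x) is at most the distance from
  \<open>x\<close> to any \<open>a\<close> outside that interval, and the exponential absorbs a pole
  of any order. The quadratic bound makes the derivative at \<open>a\<close> vanish.\<close>

lemma bump_le:
  assumes "a \<le> 0 \<or> 1 \<le> a"
  shows "\<exists>C. \<forall>x. \<bar>bump p m x\<bar> \<le> C * (x - a)\<^sup>2"
proof -
  have "compact (poly p ` {0..1})"
    by (intro compact_continuous_image continuous_intros) simp
  then obtain B where B: "\<And>x. x \<in> {0..1} \<Longrightarrow> \<bar>poly p x\<bar> \<le> B"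
    by (metis compact_imp_bounded bounded_iff image_eqI real_norm_def)
  have "\<bar>bump p m x\<bar> \<le> B * fact (m + 2) * (x - a)\<^sup>2" for x
  proof (cases "0 < x \<and> x < 1")
    case True
    define q where "q = x * (1 - x)"
    have q: "0 < q" "q \<le> \<bar>x - a\<bar>"
    proof -
      show "0 < q" using True by (simp add: q_def)
      have "q \<le> x" "q \<le> 1 - x" using True mult_left_mono[of "1-x" 1 x] mult_right_mono[of x 1 "1-x"] by (simp_all add: q_def)
      then show "q \<le> \<bar>x - a\<bar>" using assms by linarith
    qed
    have "\<bar>bump p m x\<bar> = \<bar>poly p x\<bar> * inverse q ^ m * exp (- inverse q)"
      using True q by (simp add: bump_def q_def abs_mult)
    \<comment> \<open>Of the m + 2 powers of \<open>q\<close> gained from the exponential,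
      \<open>m\<close> cancel the pole and two remain for the square.\<close>
    also have "\<dots> \<le> B * inverse q ^ m * (fact (m + 2) * q ^ (m + 2))"
      using q True B[of x] by (intro mult_mono mult_right_mono exp_minus_inverse_le) auto
    also have "\<dots> = B * fact (m + 2) * q\<^sup>2"
      using q by (simp add: power_add power2_eq_square field_simps)
    also have "\<dots> \<le> B * fact (m + 2) * \<bar>x - a\<bar>\<^sup>2"
      using q B[of 0] by (intro mult_left_mono power_mono) auto
    finally show ?thesis by simp
  next
    case False
    then have "bump p m x = 0" unfolding bump_def by (rule if_not_P)
    then show ?thesis using B[of 0] by simp
  qed
  then show ?thesis by blast
qed

text \<open>With q = x (1 - x), represented by \<open>[:0, 1, -1:]\<close>, and q' = 1 - 2 x,
  represented by \<open>[:1, -2:]\<close>, the product rule gives (p' q^2 + p q' (1 - m q)) q^(-m-2)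
  exp(-1/q).\<close>

lemma bump_deriv:
  "(bump p m has_real_derivative
    bump (pderiv p * [:0, 1, -1:]\<^sup>2 + p * [:1, -2:] * (1 - of_nat m * [:0, 1, -1:])) (m + 2) x) (at x)"
proof (cases "0 < x \<and> x < 1")
  case True
  define q where "q = x * (1 - x)"
  have q: "q \<noteq> 0" using True by (simp add: q_def)
  have dq: "((\<lambda>x. x * (1 - x)) has_real_derivative 1 - 2 * x) (at x)"
    by (auto intro!: derivative_eq_intros)
  define i where "i = inverse q"
  define e where "e = exp (- i)"
  have qi: "q * i = 1" using q by (simp add: i_def)
  have di: "((\<lambda>x. inverse (x * (1 - x))) has_real_derivative - ((1 - 2 * x) * i\<^sup>2)) (at x)"
    using DERIV_inverse_fun[OF dq] q by (simp add: q_def[symmetric] i_def power2_eq_square)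
  have dn: "((\<lambda>x. inverse (x * (1 - x)) ^ m) has_real_derivative - (of_nat m * (1 - 2 * x) * i ^ (m + 1))) (at x)"
    using DERIV_power[OF di, of m] by (cases m) (simp_all add: q_def[symmetric] i_def[symmetric] power2_eq_square mult_ac)
  have de: "((\<lambda>x. exp (- inverse (x * (1 - x)))) has_real_derivative e * ((1 - 2 * x) * i\<^sup>2)) (at x)"
    using DERIV_fun_exp[OF DERIV_minus[OF di]] by (simp add: q_def[symmetric] i_def[symmetric] e_def)
  have "((\<lambda>x. poly p x * inverse (x * (1 - x)) ^ m * exp (- inverse (x * (1 - x)))) has_real_derivative
      (poly (pderiv p) x * i ^ m - of_nat m * (1 - 2 * x) * i ^ (m + 1) * poly p x) * e
      + e * ((1 - 2 * x) * i\<^sup>2) * (poly p x * i ^ m)) (at x)"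
    using DERIV_mult[OF DERIV_mult[OF poly_DERIV dn] de]
    by (simp add: q_def[symmetric] i_def[symmetric] e_def[symmetric])
  \<comment> \<open>Factors \<open>q * i\<close>, equal to 1, are inserted so that
    \<open>i ^ (m + 2)\<close> can be taken out of every term.\<close>
  also have "(poly (pderiv p) x * i ^ m - of_nat m * (1 - 2 * x) * i ^ (m + 1) * poly p x) * e
      + e * ((1 - 2 * x) * i\<^sup>2) * (poly p x * i ^ m)
    = (poly (pderiv p) x * (q * i)\<^sup>2 * i ^ m + poly p x * (1 - 2 * x) * (i ^ (m + 2) - of_nat m * (q * i) * i ^ (m + 1))) * e"
    unfolding qi by (simp add: power2_eq_square algebra_simps)
  also have "\<dots> = (poly (pderiv p) x * q\<^sup>2 + poly p x * (1 - 2 * x) * (1 - of_nat m * q)) * i ^ (m + 2) * e"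
    by (simp add: power2_eq_square algebra_simps)
  also have "\<dots> = bump (pderiv p * [:0, 1, -1:]\<^sup>2 + p * [:1, -2:] * (1 - of_nat m * [:0, 1, -1:])) (m + 2) x"
    using True by (simp add: bump_def q_def[symmetric] i_def e_def poly_power of_nat_poly) (simp add: q_def algebra_simps)
  finally show ?thesis
  proof (rule has_field_derivative_transform_within_open)
    show "poly p y * inverse (y * (1 - y)) ^ m * exp (- inverse (y * (1 - y))) = bump p m y"
      if "y \<in> {0<..<1}" for y using that by (simp add: bump_def)
  qed (use True in auto)
next
  case False
  \<comment> \<open>Taking \<open>a = x\<close> gives both \<open>bump p m x = 0\<close> and a
    difference quotient of order \<bar>y - x\<bar>.\<close>
  then obtain C where C: "\<And>y. \<bar>bump p m y\<bar> \<le> C * (y - x)\<^sup>2"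
    using bump_le[of x p m] by (meson linorder_not_le)
  have "((\<lambda>y. (bump p m y - bump p m x) / (y - x)) \<longlongrightarrow> 0) (at x)"
  proof (rule Lim_null_comparison)
    show "\<forall>\<^sub>F y in at x. norm ((bump p m y - bump p m x) / (y - x)) \<le> C * \<bar>y - x\<bar>"
    proof (rule eventually_at_filter[THEN iffD2], intro always_eventually allI impI)
      fix y assume "y \<noteq> x"
      moreover have "\<bar>bump p m y\<bar> \<le> C * \<bar>y - x\<bar> * \<bar>y - x\<bar>" "bump p m x = 0"
        using C[of y] C[of x] by (simp_all add: power2_eq_square mult.assoc)
      ultimately show "norm ((bump p m y - bump p m x) / (y - x)) \<le> C * \<bar>y - x\<bar>"
        by (simp add: divide_le_eq)
    qed
    show "((\<lambda>y. C * \<bar>y - x\<bar>) \<longlongrightarrow> 0) (at x)"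
      by (rule tendsto_eq_intros refl | simp)+
  qed
  moreover have "bump p' m' x = 0" for p' m' unfolding bump_def by (rule if_not_P[OF False])
  ultimately show ?thesis by (simp add: has_field_derivative_iff)
qed

lemma smooth_bump: "smooth (bump p m)"
  by (rule smooth_coinduct[where S = "{bump p m | p m. True}"]) (blast intro: bump_deriv)+

text \<open>The integral of a bump, divided by its total mass. Rescaled copies of \<psi> serve as
  cutoffs, and rescaled copies of its derivative as mollifiers.\<close>

lemma smooth_step:
  obtains \<psi> \<psi>' :: "real \<Rightarrow> real" where "smooth \<psi>" "smooth \<psi>'"
    "\<And>x. (\<psi> has_real_derivative \<psi>' x) (at x)" "\<And>x. 0 \<le> \<psi>' x"
    "\<And>x. x \<le> 0 \<Longrightarrow> \<psi> x = 0" "\<And>x. 1 \<le> x \<Longrightarrow> \<psi> x = 1" "\<And>x. x \<notin> {0<..<1} \<Longrightarrow> \<psi>' x = 0"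
proof -
  define b where "b = bump 1 0"
  have b: "smooth b" "\<And>x. 0 \<le> b x" "\<And>x. x \<notin> {0<..<1} \<Longrightarrow> b x = 0" "b (1/2) > 0"
    by (auto simp: b_def smooth_bump bump_def)
  define s where "s x = (LBINT y=ereal 0..ereal x. b y)" for x :: real
  have s: "(s has_real_derivative b x) (at x)" for x
  proof -
    \<comment> \<open>The interval exceeds the hull of 0 and \<open>x\<close> by 1 on each side, so
      \<open>x\<close> is interior and the derivative is two-sided; the oriented integral covers
      negative \<open>x\<close> as well.\<close>
    have "((\<lambda>u. LBINT y=ereal 0..ereal u. b y) has_vector_derivative b x) (at x within {min 0 x - 1..max 0 x + 1})"
      using smooth_continuous[OF b(1)] by (intro interval_integral_FTC2) auto
    moreover have "x \<in> interior {min 0 x - 1..max 0 x + 1}" by (simp add: min_def max_def)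
    ultimately show ?thesis
      unfolding s_def[abs_def]
      by (metis at_within_interior has_real_derivative_iff_has_vector_derivative)
  qed
  have mono: "s x \<le> s y" if "x \<le> y" for x y
    using that s b(2) by (meson DERIV_nonneg_imp_nondecreasing)
  have s0: "s 0 = 0" by (simp add: s_def)
  have neg: "s x = 0" if "x \<le> 0" for x
  proof (rule ccontr)
    assume ne: "s x \<noteq> 0"
    then have "x < 0" using that s0 by (cases "x = 0") auto
    then obtain z where "x < z" "z < 0" "s 0 - s x = (0 - x) * b z"
      using MVT2[of x 0 s b] s by auto
    then show False using ne b(3)[of z] s0 by simp
  qed
  have pos: "s x = s 1" if "1 \<le> x" for x
  proof (rule ccontr)
    assume ne: "s x \<noteq> s 1"
    then have "1 < x" using that by (cases "x = 1") auto
    then obtain z where "1 < z" "z < x" "s x - s 1 = (x - 1) * b z"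
      using MVT2[of 1 x s b] s by auto
    then show False using ne b(3)[of z] by simp
  qed
  \<comment> \<open>Otherwise the monotone \<open>s\<close> would vanish on the unit interval,
    contradicting the positive derivative at 1/2.\<close>
  have "0 < s 1"
  proof (rule ccontr)
    assume "\<not> 0 < s 1"
    then have z: "s y = 0" if "y \<in> {0..1}" for y using that mono[of 0 y] mono[of y 1] s0 by auto
    have "(s has_real_derivative 0) (at (1/2))"
    proof (rule has_field_derivative_transform_within_open[of "\<lambda>_. 0"])
      show "((\<lambda>_. 0) has_real_derivative 0) (at (1/2))" by simp
    qed (use z in \<open>auto intro: open_greaterThanLessThan[of 0 1]\<close>)
    then show False using DERIV_unique[OF s] b(4) by fastforce
  qed
  show thesis
  proof (rule that[of "\<lambda>x. inverse (s 1) * s x" "\<lambda>x. inverse (s 1) * b x"])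
    show "smooth (\<lambda>x. inverse (s 1) * s x)" "smooth (\<lambda>x. inverse (s 1) * b x)"
      using smooth_antiderivative[OF b(1) s] b(1) by (auto intro: smooth_mult_left)
    show "((\<lambda>x. inverse (s 1) * s x) has_real_derivative inverse (s 1) * b x) (at x)" for x
      by (intro DERIV_cmult s)
    show "inverse (s 1) * s x = 1" if "1 \<le> x" for x
      using pos[OF that] \<open>0 < s 1\<close> by simp
  qed (use \<open>0 < s 1\<close> b neg in auto)
qed

section \<open>Weak derivatives\<close>

text \<open>Since r \<le> 1 + r^2 and constants are integrable over a bounded interval.\<close>

lemma L2_imp_integrable:
  fixes f :: "real \<Rightarrow> 'a::{banach, second_countable_topology}"
  assumes "f \<in> L2 T"
  shows "integrable (lebesgue_on {0..T}) f"
proof (rule Bochner_Integration.integrable_bound)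
  show "integrable (lebesgue_on {0..T}) (\<lambda>t. 1 + (norm (f t))\<^sup>2)"
    using assms Bochner_Integration.integrable_add[OF continuous_imp_integrable_real[OF continuous_on_const]]
    by (simp add: L2_def)
  have "norm (f t) \<le> 1 + (norm (f t))\<^sup>2" for t
    using sum_squares_bound[of 1 "norm (f t)"] norm_ge_zero[of "f t"] by (simp del: norm_ge_zero)
  then show "AE t in lebesgue_on {0..T}. norm (f t) \<le> norm (1 + (norm (f t))\<^sup>2)"
    by simp
qed (use assms in \<open>simp add: L2_def\<close>)

lemma continuous_imp_L2:
  fixes f :: "real \<Rightarrow> 'a::{banach, second_countable_topology}"
  assumes "continuous_on {0..T} f"
  shows "f \<in> L2 T"
  unfolding L2_def
  using assms by (auto intro!: continuous_imp_measurable_on_sets_lebesgue continuous_imp_integrable_real continuous_intros)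

lemma integrable_continuous_scaleR:
  fixes f :: "real \<Rightarrow> 'a::{banach, second_countable_topology}"
  assumes "continuous_on {a..b} g" "integrable (lebesgue_on {a..b}) f"
  shows "integrable (lebesgue_on {a..b}) (\<lambda>t. g t *\<^sub>R f t)"
proof -
  have "compact (g ` {a..b})" using assms(1) by (intro compact_continuous_image) auto
  then obtain C where C: "\<And>t. t \<in> {a..b} \<Longrightarrow> norm (g t) \<le> C"
    by (metis compact_imp_bounded bounded_iff image_eqI)
  show ?thesis
  proof (rule Bochner_Integration.integrable_bound)
    show "integrable (lebesgue_on {a..b}) (\<lambda>t. C *\<^sub>R norm (f t))"
      using assms(2) by auto
    show "(\<lambda>t. g t *\<^sub>R f t) \<in> borel_measurable (lebesgue_on {a..b})"
      using continuous_imp_measurable_on_sets_lebesgue[OF assms(1)] borel_measurable_integrable[OF assms(2)]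
      by (intro borel_measurable_scaleR) simp_all
    show "AE t in lebesgue_on {a..b}. norm (g t *\<^sub>R f t) \<le> norm (C *\<^sub>R norm (f t))"
    proof (rule AE_I2)
      fix t assume "t \<in> space (lebesgue_on {a..b})"
      then have "norm (g t) * norm (f t) \<le> \<bar>C\<bar> * norm (f t)"
        using C[of t] by (intro mult_right_mono) auto
      then show "norm (g t *\<^sub>R f t) \<le> norm (C *\<^sub>R norm (f t))" by (simp add: abs_mult)
    qed
  qed
qed

section \<open>Test functions and operations on weak derivatives\<close>

lemma test_functionsI:
  assumes "smooth \<phi>" "0 < a" "b < T" "\<And>t. t \<notin> {a..b} \<Longrightarrow> \<phi> t = 0"
  shows "\<phi> \<in> test_functions T"
proof -
  have "{t. \<phi> t \<noteq> 0} \<subseteq> {a..b}" using assms(4) by blast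
  then have "closure {t. \<phi> t \<noteq> 0} \<subseteq> {a..b}" by (intro closure_minimal) auto
  then show ?thesis
    using assms smooth_imp_deriv_differentiable[OF assms(1)]
    by (force simp: test_functions_def compact_eq_bounded_closed intro: bounded_subset[of "{a..b}"])
qed

lemma test_function_continuous:
  assumes "\<phi> \<in> test_functions T"
  shows "continuous_on S \<phi>" "continuous_on S (deriv \<phi>)"
proof -
  have "(deriv ^^ n) \<phi> differentiable_on UNIV" for n
    using assms by (simp add: test_functions_def)
  from this[of 0] this[of 1] show "continuous_on S \<phi>" "continuous_on S (deriv \<phi>)"
    by (auto intro: differentiable_imp_continuous_on continuous_on_subset)
qed

text \<open>Bounded linear maps commute with the Bochner integral. Applied to coordinate
  functionals, this reduces the equation in \<open>H\<close> to scalar equations.\<close>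

lemma weak_deriv_bounded_linear:
  fixes u :: "real \<Rightarrow> 'a::{banach, second_countable_topology}"
    and L :: "'a \<Rightarrow> 'b::{banach, second_countable_topology}"
  assumes "weak_deriv T u u'" "u \<in> L2 T" "u' \<in> L2 T" "bounded_linear L"
  shows "weak_deriv T (\<lambda>t. L (u t)) (\<lambda>t. L (u' t))"
  unfolding weak_deriv_def
proof
  fix \<phi> assume \<phi>: "\<phi> \<in> test_functions T"
  interpret L: bounded_linear L by fact
  have [simp]: "(\<integral>t. g t *\<^sub>R L (f t) \<partial>lebesgue_on {0..T}) = L (\<integral>t. g t *\<^sub>R f t \<partial>lebesgue_on {0..T})"
    if "continuous_on {0..T} g" "f \<in> L2 T" for g and f :: "real \<Rightarrow> 'a"
    using integral_bounded_linear[OF assms(4) integrable_continuous_scaleR[OF that(1) L2_imp_integrable[OF that(2)]]]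
    by (simp add: L.scaleR)
  show "(\<integral>t. deriv \<phi> t *\<^sub>R L (u t) \<partial>lebesgue_on {0..T}) = - (\<integral>t. \<phi> t *\<^sub>R L (u' t) \<partial>lebesgue_on {0..T})"
    using assms \<phi> test_function_continuous[OF \<phi>] by (simp add: weak_deriv_def linear_neg[OF L.linear])
qed

text \<open>Permits passing to the continuous representative of a function and to a continuous
  formula for its derivative.\<close>

lemma weak_deriv_cong_AE:
  fixes u v :: "real \<Rightarrow> 'a::{banach, second_countable_topology}"
  assumes "weak_deriv T u u'" "AE t in lebesgue_on {0..T}. u t = v t" "AE t in lebesgue_on {0..T}. u' t = v' t"
    "u \<in> borel_measurable (lebesgue_on {0..T})" "v \<in> borel_measurable (lebesgue_on {0..T})"
    "u' \<in> borel_measurable (lebesgue_on {0..T})" "v' \<in> borel_measurable (lebesgue_on {0..T})"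
  shows "weak_deriv T v v'"
  unfolding weak_deriv_def
proof
  fix \<phi> assume \<phi>: "\<phi> \<in> test_functions T"
  note c = test_function_continuous[OF \<phi>, THEN continuous_imp_measurable_on_sets_lebesgue]
  have [measurable]: "\<phi> \<in> borel_measurable (lebesgue_on {0..T})" "deriv \<phi> \<in> borel_measurable (lebesgue_on {0..T})"
    by (auto intro: c)
  note [measurable] = assms(4-)
  have "(\<integral>t. deriv \<phi> t *\<^sub>R v t \<partial>lebesgue_on {0..T}) = (\<integral>t. deriv \<phi> t *\<^sub>R u t \<partial>lebesgue_on {0..T})"
    using assms(2) by (intro integral_cong_AE) auto
  moreover have "(\<integral>t. \<phi> t *\<^sub>R v' t \<partial>lebesgue_on {0..T}) = (\<integral>t. \<phi> t *\<^sub>R u' t \<partial>lebesgue_on {0..T})"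
    using assms(3) by (intro integral_cong_AE) auto
  ultimately show "(\<integral>t. deriv \<phi> t *\<^sub>R v t \<partial>lebesgue_on {0..T}) = - (\<integral>t. \<phi> t *\<^sub>R v' t \<partial>lebesgue_on {0..T})"
    using assms(1) \<phi> by (simp add: weak_deriv_def)
qed

section \<open>From weak to classical derivatives\<close>

lemma approximate_identity:
  fixes f :: "real \<Rightarrow> 'a::{banach, second_countable_topology}"
  assumes f: "continuous_on {0..T} f"
    and \<rho>: "continuous_on UNIV \<rho>" "\<And>x. x \<notin> {0<..<1} \<Longrightarrow> \<rho> x = 0"
    and a: "0 \<le> a" "a < T"
  shows "(\<lambda>n. \<integral>t. (real (Suc n) * \<rho> (real (Suc n) * (t - a))) *\<^sub>R f t \<partial>lebesgue_on {0..T})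
    \<longlonglongrightarrow> (\<integral>x. \<rho> x \<partial>lborel) *\<^sub>R f a"
proof -
  \<comment> \<open>A continuous extension of \<open>f\<close> to the line, constant outside the
    interval, so that the substitution can be made in an integral over all reals.\<close>
  define g where "g t = f (max 0 (min T t))" for t
  have g: "continuous_on UNIV g" unfolding g_def
    using a by (intro continuous_on_compose2[OF f] continuous_intros) auto
  have gm [measurable]: "g \<in> borel_measurable borel" "\<rho> \<in> borel_measurable borel"
    using g \<rho> by (auto intro: borel_measurable_continuous_onI)
  obtain B where B: "\<And>t. norm (g t) \<le> B"
  proof -
    have "compact (f ` {0..T})" using f by (intro compact_continuous_image) auto
    then obtain B where B: "\<And>t. t \<in> {0..T} \<Longrightarrow> norm (f t) \<le> B"
      by (metis compact_imp_bounded bounded_iff image_eqI)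
    then show thesis using a by (intro that[of B]) (auto simp: g_def)
  qed
  have \<rho>i: "integrable lborel \<rho>"
  proof -
    have "integrable lborel (\<lambda>x. indicator {0..1} x *\<^sub>R \<rho> x)"
      by (intro borel_integrable_compact continuous_on_subset[OF \<rho>(1)]) auto
    moreover have "(\<lambda>x. indicator {0..1} x *\<^sub>R \<rho> x) = \<rho>"
    proof
      show "indicator {0..1} x *\<^sub>R \<rho> x = \<rho> x" for x
        using \<rho>(2)[of x] by (cases "x \<in> {0..1}") auto
    qed
    ultimately show ?thesis by simp
  qed
  \<comment> \<open>This is the limit after substituting t = a + x / (n + 1); the integrand
    converges by continuity of \<open>g\<close>.\<close>
  have lim: "(\<lambda>n. \<integral>x. \<rho> x *\<^sub>R g (a + x / real (Suc n)) \<partial>lborel) \<longlonglongrightarrow> (\<integral>x. \<rho> x *\<^sub>R g a \<partial>lborel)"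
  proof (rule integral_dominated_convergence)
    show "integrable lborel (\<lambda>x. B * norm (\<rho> x))" using \<rho>i by auto
    have "(\<lambda>n. a + x / real (Suc n)) \<longlonglongrightarrow> a + 0" for x
      by (intro tendsto_add tendsto_const LIMSEQ_Suc[OF lim_const_over_n])
    then show "AE x in lborel. (\<lambda>n. \<rho> x *\<^sub>R g (a + x / real (Suc n))) \<longlonglongrightarrow> \<rho> x *\<^sub>R g a"
      using g by (intro AE_I2 tendsto_scaleR tendsto_const continuous_on_tendsto_compose[OF g]) auto
    show "AE x in lborel. norm (\<rho> x *\<^sub>R g (a + x / real (Suc n))) \<le> B * norm (\<rho> x)" for n
      using B by (intro AE_I2) (subst mult.commute, simp add: mult_left_mono)
  qed measurable
  \<comment> \<open>For such \<open>n\<close> the rescaled kernel vanishes outside {0..T}, hence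
    replacing \<open>f\<close> by \<open>g\<close> on the whole line changes nothing.\<close>
  have eq: "(\<integral>t. (real (Suc n) * \<rho> (real (Suc n) * (t - a))) *\<^sub>R f t \<partial>lebesgue_on {0..T})
     = (\<integral>x. \<rho> x *\<^sub>R g (a + x / real (Suc n)) \<partial>lborel)" if n: "1 / (T - a) \<le> real (Suc n)" for n
  proof -
    let ?N = "real (Suc n)"
    have N: "1 \<le> ?N * (T - a)" using n a by (simp add: field_simps)
    have z: "\<rho> (?N * (t - a)) = 0" if "t \<notin> {0..T}" for t
    proof (rule \<rho>(2))
      show "?N * (t - a) \<notin> {0<..<1}"
      proof (cases "t < 0")
        case True
        then have "?N * (t - a) \<le> 0" using a by (intro mult_nonneg_nonpos) auto
        then show ?thesis by simp
      next
        case False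
        then have "?N * (T - a) \<le> ?N * (t - a)" using that by (intro mult_left_mono) auto
        then have "1 \<le> ?N * (t - a)" using N by linarith
        then show ?thesis by auto
      qed
    qed
    have "(\<integral>t. (?N * \<rho> (?N * (t - a))) *\<^sub>R f t \<partial>lebesgue_on {0..T})
      = (\<integral>t. indicator {0..T} t *\<^sub>R (?N * \<rho> (?N * (t - a))) *\<^sub>R f t \<partial>lebesgue)"
      by (rule integral_restrict_space) simp
    also have "(\<lambda>t. indicator {0..T} t *\<^sub>R (?N * \<rho> (?N * (t - a))) *\<^sub>R f t) = (\<lambda>t. (?N * \<rho> (?N * (t - a))) *\<^sub>R g t)"
      using z by (auto simp: fun_eq_iff indicator_def g_def)
    also have "integral\<^sup>L lebesgue \<dots> = integral\<^sup>L lborel \<dots>"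
      by (rule integral_completion) measurable
    also have "\<dots> = \<bar>1 / ?N\<bar> *\<^sub>R (\<integral>x. (?N * \<rho> (?N * ((a + 1 / ?N * x) - a))) *\<^sub>R g (a + 1 / ?N * x) \<partial>lborel)"
      by (rule lborel_integral_real_affine) simp
    also have "\<dots> = (\<integral>x. \<rho> x *\<^sub>R g (a + x / ?N) \<partial>lborel)"
      by (subst integral_scaleR_right[symmetric]) (simp del: of_nat_Suc)
    finally show ?thesis .
  qed
  obtain m :: nat where m: "1 / (T - a) \<le> real m" using real_arch_simple by blast
  have "\<forall>\<^sub>F n in sequentially. (\<integral>t. (real (Suc n) * \<rho> (real (Suc n) * (t - a))) *\<^sub>R f t \<partial>lebesgue_on {0..T})
     = (\<integral>x. \<rho> x *\<^sub>R g (a + x / real (Suc n)) \<partial>lborel)"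
    using m by (intro eventually_sequentiallyI[of m] eq) auto
  moreover have "(\<integral>x. \<rho> x *\<^sub>R g a \<partial>lborel) = (\<integral>x. \<rho> x \<partial>lborel) *\<^sub>R f a"
    using a \<rho>i by (simp add: g_def)
  ultimately show ?thesis
    using lim by (simp add: tendsto_cong)
qed

text \<open>Test with smooth approximations of the indicator function of \<open>{a<..b}\<close>.\<close>

lemma weak_deriv_increment:
  fixes u :: "real \<Rightarrow> 'a::{banach, second_countable_topology}"
  assumes wd: "weak_deriv T u g" and u: "continuous_on {0..T} u" and g: "integrable (lebesgue_on {0..T}) g"
    and ab: "0 < a" "a \<le> b" "b < T"
  shows "u b - u a = (\<integral>t. indicator {a<..b} t *\<^sub>R g t \<partial>lebesgue_on {0..T})"
proof -
  obtain \<psi> \<psi>' where \<psi>: "smooth \<psi>" "smooth \<psi>'" "\<And>x. (\<psi> has_real_derivative \<psi>' x) (at x)" "\<And>x. 0 \<le> \<psi>' x"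
    "\<And>x. x \<le> 0 \<Longrightarrow> \<psi> x = 0" "\<And>x. 1 \<le> x \<Longrightarrow> \<psi> x = 1" "\<And>x. x \<notin> {0<..<1} \<Longrightarrow> \<psi>' x = 0"
    by (rule smooth_step) blast
  have mono: "\<psi> x \<le> \<psi> y" if "x \<le> y" for x y
    using that \<psi>(3,4) by (meson DERIV_nonneg_imp_nondecreasing)
  have \<psi>01: "0 \<le> \<psi> x" "\<psi> x \<le> 1" for x
    using mono[of "min x 0" x] mono[of x "max x 1"] \<psi>(5,6) by auto
  have one: "(\<integral>x. \<psi>' x \<partial>lborel) = 1"
  proof -
    have "has_bochner_integral lborel (\<lambda>x. indicator {0..1} x *\<^sub>R \<psi>' x) (\<psi> 1 - \<psi> 0)"
      using \<psi> smooth_continuous[OF \<psi>(2), of UNIV]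
      by (intro has_bochner_integral_FTC_Icc)
         (auto simp: has_real_derivative_iff_has_vector_derivative has_vector_derivative_at_within intro: continuous_on_subset)
    moreover have "(\<lambda>x. indicator {0..1} x *\<^sub>R \<psi>' x) = \<psi>'"
    proof
      show "indicator {0..1} x *\<^sub>R \<psi>' x = \<psi>' x" for x
        using \<psi>(7)[of x] by (cases "x \<in> {0..1}") auto
    qed
    ultimately show ?thesis using \<psi>(5,6) by (simp add: has_bochner_integral_iff)
  qed
  \<comment> \<open>Each step starts to rise at its own base point and is complete after 1 / (n +
    1). In the limit the value at \<open>a\<close> is therefore 0, and for a < b the value at
    \<open>b\<close> is 1, whence the half-open interval.\<close>
  define \<phi> where "\<phi> n t = \<psi> (real (Suc n) * (t - a)) - \<psi> (real (Suc n) * (t - b))" for n t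
  have \<phi>_smooth: "smooth (\<phi> n)" for n
    unfolding \<phi>_def[abs_def] by (intro smooth_diff smooth_affine \<psi>)
  have d\<phi>: "deriv (\<phi> n) t = real (Suc n) * \<psi>' (real (Suc n) * (t - a)) - real (Suc n) * \<psi>' (real (Suc n) * (t - b))" for n t
    unfolding \<phi>_def[abs_def]
    by (rule DERIV_imp_deriv) (rule derivative_eq_intros DERIV_chain'[OF _ \<psi>(3)] refl | simp)+
  \<comment> \<open>For these \<open>n\<close> the second step is complete at the midpoint of
    \<open>b\<close> and \<open>T\<close>, after which the two steps cancel.\<close>
  have test: "\<phi> n \<in> test_functions T" if n: "2 / (T - b) \<le> real (Suc n)" for n
  proof (rule test_functionsI[OF \<phi>_smooth ab(1), where b = "(b + T) / 2"])
    show "(b + T) / 2 < T" using ab by simp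
    fix t assume t: "t \<notin> {a..(b + T) / 2}"
    have N: "2 \<le> real (Suc n) * (T - b)" using n ab by (simp add: field_simps)
    show "\<phi> n t = 0"
    proof (cases "t < a")
      case True
      then have "real (Suc n) * (t - a) \<le> 0" "real (Suc n) * (t - b) \<le> 0"
        using ab by (auto intro: mult_nonneg_nonpos)
      then show ?thesis by (simp add: \<phi>_def \<psi>(5))
    next
      case False
      then have "real (Suc n) * ((T - b) / 2) \<le> real (Suc n) * (t - b)" "real (Suc n) * (t - b) \<le> real (Suc n) * (t - a)"
        using t ab by (intro mult_left_mono; simp)+
      then have "1 \<le> real (Suc n) * (t - b)" "1 \<le> real (Suc n) * (t - a)" using N by linarith+
      then show ?thesis by (simp add: \<phi>_def \<psi>(6) del: of_nat_Suc)
    qed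
  qed
  have int: "integrable (lebesgue_on {0..T}) (\<lambda>t. (real (Suc n) * \<psi>' (real (Suc n) * (t - c))) *\<^sub>R u t)" for n c
    using u by (intro integrable_continuous_scaleR L2_imp_integrable continuous_imp_L2 continuous_intros
        continuous_on_compose2[OF smooth_continuous[OF \<psi>(2), of UNIV]]) auto
  \<comment> \<open>The derivative of \<open>\<phi> n\<close> is a kernel of mass 1 concentrating at
    \<open>a\<close> minus one concentrating at \<open>b\<close>. The resulting sign is undone by
    the minus sign in \<open>weak_deriv\<close>.\<close>
  have lim1: "(\<lambda>n. \<integral>t. deriv (\<phi> n) t *\<^sub>R u t \<partial>lebesgue_on {0..T}) \<longlonglongrightarrow> 1 *\<^sub>R u a - 1 *\<^sub>R u b"
    unfolding d\<phi> scaleR_diff_left Bochner_Integration.integral_diff[OF int int]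
    using ab u \<psi> smooth_continuous[OF \<psi>(2), of UNIV]
    by (intro tendsto_diff; subst one[symmetric]; intro approximate_identity) auto
  have lim2: "(\<lambda>n. \<integral>t. \<phi> n t *\<^sub>R g t \<partial>lebesgue_on {0..T}) \<longlonglongrightarrow> (\<integral>t. indicator {a<..b} t *\<^sub>R g t \<partial>lebesgue_on {0..T})"
  proof (rule integral_dominated_convergence)
    show "integrable (lebesgue_on {0..T}) (\<lambda>t. norm (g t))" using g by auto
    have [measurable]: "\<phi> n \<in> borel_measurable (lebesgue_on {0..T})" for n
      by (intro continuous_imp_measurable_on_sets_lebesgue smooth_continuous \<phi>_smooth) auto
    have [measurable]: "g \<in> borel_measurable (lebesgue_on {0..T})" using g by auto
    show "(\<lambda>t. \<phi> n t *\<^sub>R g t) \<in> borel_measurable (lebesgue_on {0..T})" for n by measurable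
    have "(indicator {a<..b} :: real \<Rightarrow> real) \<in> borel_measurable (lebesgue_on {0..T})"
      by (intro measurable_restrict_space1 borel_measurable_indicator) simp
    then show "(\<lambda>t. indicator {a<..b} t *\<^sub>R g t) \<in> borel_measurable (lebesgue_on {0..T})" by measurable
    have "\<bar>\<phi> n t\<bar> \<le> 1" for n t
      using \<psi>01[of "real (Suc n) * (t - a)"] \<psi>01[of "real (Suc n) * (t - b)"] by (simp add: \<phi>_def abs_le_iff)
    then show "AE t in lebesgue_on {0..T}. norm (\<phi> n t *\<^sub>R g t) \<le> norm (g t)" for n
      by (intro AE_I2) (simp add: mult_left_le_one_le)
    have \<psi>_lim: "(\<lambda>n. \<psi> (real (Suc n) * (t - c))) \<longlonglongrightarrow> indicator {c<..} t" for t c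
    proof (cases "c < t")
      case True
      obtain m :: nat where m: "1 / (t - c) \<le> real m" using real_arch_simple by blast
      have "\<psi> (real (Suc n) * (t - c)) = 1" if "m \<le> n" for n
      proof (rule \<psi>(6))
        have "1 / (t - c) \<le> real (Suc n)" using m that by linarith
        then show "1 \<le> real (Suc n) * (t - c)" using True by (simp add: field_simps)
      qed
      then show ?thesis
        using True by (intro tendsto_eventually eventually_sequentiallyI[of m]) auto
    next
      case False
      then have "real (Suc n) * (t - c) \<le> 0" for n by (intro mult_nonneg_nonpos) auto
      then show ?thesis using False \<psi>(5) by simp
    qed
    have ind: "indicator {a<..} t - indicator {b<..} t = (indicator {a<..b} t :: real)" for t
      using ab by (auto simp: indicator_def)
    have "(\<lambda>n. \<phi> n t) \<longlonglongrightarrow> indicator {a<..b} t" for t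
      using tendsto_diff[OF \<psi>_lim[where t = t and c = a] \<psi>_lim[where t = t and c = b]]
      unfolding \<phi>_def ind .
    then show "AE t in lebesgue_on {0..T}. (\<lambda>n. \<phi> n t *\<^sub>R g t) \<longlonglongrightarrow> indicator {a<..b} t *\<^sub>R g t"
      by (intro AE_I2 tendsto_scaleR tendsto_const)
  qed
  obtain m :: nat where m: "2 / (T - b) \<le> real m" using real_arch_simple by blast
  have "\<forall>\<^sub>F n in sequentially. (\<integral>t. deriv (\<phi> n) t *\<^sub>R u t \<partial>lebesgue_on {0..T}) = - (\<integral>t. \<phi> n t *\<^sub>R g t \<partial>lebesgue_on {0..T})"
    using wd test m by (intro eventually_sequentiallyI[of m]) (force simp: weak_deriv_def)
  then have "(\<lambda>n. \<integral>t. deriv (\<phi> n) t *\<^sub>R u t \<partial>lebesgue_on {0..T}) \<longlonglongrightarrow> - (\<integral>t. indicator {a<..b} t *\<^sub>R g t \<partial>lebesgue_on {0..T})"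
    using tendsto_minus[OF lim2] by (simp add: tendsto_cong)
  from LIMSEQ_unique[OF lim1 this] show ?thesis
    by (metis minus_diff_eq scaleR_one equation_minus_iff)
qed

text \<open>Increments of \<open>u\<close> are integrals of \<open>g\<close>, so the fundamental
  theorem of calculus applies to continuous \<open>g\<close>. This turns weak scalar equations into
  classical ones.\<close>

lemma weak_deriv_imp_has_vector_derivative:
  fixes u :: "real \<Rightarrow> 'a::euclidean_space"
  assumes wd: "weak_deriv T u g" and u: "continuous_on {0..T} u" and g: "continuous_on {0..T} g"
    and t: "0 < t" "t < T"
  shows "(u has_vector_derivative g t) (at t)"
proof -
  \<comment> \<open>Auxiliary points strictly inside the interval:
    \<open>weak_deriv_increment\<close> excludes the endpoints 0 and \<open>T\<close>, and
    \<open>t\<close> has to be interior to {a..b}.\<close>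
  define a b where "a = t / 2" and "b = (t + T) / 2"
  have ab: "0 < a" "a < t" "t < b" "b < T" using t by (auto simp: a_def b_def)
  have incr: "u s - u a = integral {a..s} g" if s: "s \<in> {a..b}" for s
  proof -
    have gi: "integrable (lebesgue_on {0..T}) g"
      using g by (rule continuous_imp_integrable_real)
    have "g absolutely_integrable_on {a..s}"
      using s ab by (intro absolutely_integrable_continuous_real continuous_on_subset[OF g]) auto
    then have "g absolutely_integrable_on {a<..s}"
      by (rule set_integrable_subset) auto
    then have gas: "integrable (lebesgue_on {a<..s}) g"
      by (rule absolutely_integrable_imp_integrable) simp
    have "u s - u a = (\<integral>t. indicator {a<..s} t *\<^sub>R g t \<partial>lebesgue_on {0..T})"
      using s ab by (intro weak_deriv_increment[OF wd u gi]) auto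
    also have "\<dots> = (\<integral>t. indicator {0..T} t *\<^sub>R indicator {a<..s} t *\<^sub>R g t \<partial>lebesgue)"
      by (rule integral_restrict_space) simp
    also have "(\<lambda>t. indicator {0..T} t *\<^sub>R indicator {a<..s} t *\<^sub>R g t) = (\<lambda>t. indicator {a<..s} t *\<^sub>R g t)"
      using s ab by (auto simp: indicator_def fun_eq_iff)
    also have "integral\<^sup>L lebesgue \<dots> = integral\<^sup>L (lebesgue_on {a<..s}) g"
      by (rule integral_restrict_space[symmetric]) simp
    also have "\<dots> = integral {a<..s} g"
      by (rule lebesgue_integral_eq_integral[OF gas]) simp
    also have "\<dots> = integral {a..s} g"
      by (rule integral_spike_set) (auto intro: negligible_subset[of "{a}"])
    finally show ?thesis .
  qed
  have "((\<lambda>s. u a + integral {a..s} g) has_vector_derivative 0 + g t) (at t within {a..b})"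
    using ab by (intro has_vector_derivative_add has_vector_derivative_const integral_has_vector_derivative
        continuous_on_subset[OF g]) auto
  then have "(u has_vector_derivative 0 + g t) (at t within {a..b})"
  proof (rule has_vector_derivative_transform[rotated 2])
    show "u s = u a + integral {a..s} g" if "s \<in> {a..b}" for s
      using incr[OF that] by (simp add: algebra_simps)
  qed (use ab in auto)
  moreover have "at t within {a..b} = at t"
    using ab by (intro at_within_interior) simp
  ultimately show ?thesis by simp
qed

section \<open>Complex inner products and square-summable sequences\<close>

lemma cinner_scaleC_right: "cinner x (c *\<^sub>C y) = cnj c * cinner x (y::'a::complex_inner)"
  by (metis cinner_commute cinner_scaleC_left complex_cnj_mult)

lemma cinner_add_right: "cinner x (y + z) = cinner x y + cinner x (z::'a::complex_inner)"
  by (metis cinner_commute cinner_add_left complex_cnj_add)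

lemma cinner_diff_left: "cinner (x - y) z = cinner x z - cinner y (z::'a::complex_inner)"
  using cinner_add_left[of "x - y" y z] by simp

lemma cinner_diff_right: "cinner x (y - z) = cinner x y - cinner x (z::'a::complex_inner)"
  using cinner_add_right[of x "y - z" z] by simp

lemma cinner_self: "cinner x x = complex_of_real ((norm (x::'a::complex_inner))\<^sup>2)"
proof (rule complex_eqI)
  show "Im (cinner x x) = Im (complex_of_real ((norm x)\<^sup>2))"
    using arg_cong[OF cinner_commute[of x x], of Im] by simp
qed (simp add: power2_norm_eq_inner inner_eq_Re_cinner)

lemma norm_scaleC: "norm (c *\<^sub>C x) = cmod c * norm (x::'a::complex_inner)"
proof -
  have c: "c * cnj c = (complex_of_real (cmod c))\<^sup>2"
    using complex_norm_square[of c] by simp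
  have "complex_of_real ((norm (c *\<^sub>C x))\<^sup>2) = complex_of_real ((cmod c * norm x)\<^sup>2)"
    unfolding cinner_self[symmetric] cinner_scaleC_left cinner_scaleC_right
    by (simp add: cinner_self power_mult_distrib mult.assoc[symmetric] c mult.commute[of "cnj c"])
  then have "(norm (c *\<^sub>C x))\<^sup>2 = (cmod c * norm x)\<^sup>2"
    by (simp only: of_real_eq_iff)
  then show ?thesis by (simp add: power2_eq_iff_nonneg)
qed

text \<open>Rotating \<open>x\<close> by the conjugate phase of the inner product makes the latter
  real and reduces the claim to the real Cauchy-Schwarz inequality.\<close>

lemma cmod_cinner_le: "cmod (cinner x y) \<le> norm x * norm (y::'a::complex_inner)"
proof (cases "cinner x y = 0")
  case False
  define c where "c = cnj (sgn (cinner x y))"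
  have "cinner (c *\<^sub>C x) y = complex_of_real (cmod (cinner x y))"
  proof -
    have "cinner (c *\<^sub>C x) y = cinner x y * cnj (cinner x y) / complex_of_real (cmod (cinner x y))"
      by (simp add: cinner_scaleC_left c_def sgn_eq)
    also have "\<dots> = complex_of_real (cmod (cinner x y))"
      using False by (simp add: complex_norm_square[symmetric] power2_eq_square)
    finally show ?thesis .
  qed
  then have "cmod (cinner x y) = inner (c *\<^sub>C x) y" by (simp add: inner_eq_Re_cinner)
  also have "\<dots> \<le> norm (c *\<^sub>C x) * norm y" by (rule norm_cauchy_schwarz)
  also have "norm (c *\<^sub>C x) = norm x" using False by (simp add: norm_scaleC c_def norm_sgn)
  finally show ?thesis .
qed simp

lemma continuous_on_scaleC_left:
  fixes x :: "'a::complex_inner"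
  assumes "continuous_on S f"
  shows "continuous_on S (\<lambda>t. f t *\<^sub>C x)"
proof -
  have "bounded_linear (\<lambda>c. c *\<^sub>C x)"
    by (rule bounded_linear_intro[where K = "norm x"])
       (simp_all add: scaleC_add_left scaleR_scaleC scaleC_scaleC norm_scaleC scaleR_conv_of_real)
  then show ?thesis using assms by (rule bounded_linear.continuous_on)
qed

lemma continuous_on_scaleC_right:
  fixes f :: "'b::topological_space \<Rightarrow> 'a::complex_inner"
  assumes "continuous_on S f"
  shows "continuous_on S (\<lambda>t. c *\<^sub>C f t)"
proof -
  have "bounded_linear (\<lambda>x :: 'a. c *\<^sub>C x)"
    by (rule bounded_linear_intro[where K = "cmod c"])
       (simp_all add: scaleC_add_right scaleR_scaleC scaleC_scaleC norm_scaleC mult.commute)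
  then show ?thesis using assms by (rule bounded_linear.continuous_on)
qed

lemma bounded_linear_Rep_ell2: "bounded_linear (\<lambda>x. Rep_ell2 x n)"
proof (rule bounded_linear_intro[where K = 1])
  show "Rep_ell2 (r *\<^sub>R x) n = r *\<^sub>R Rep_ell2 x n" for r x
    by (simp add: scaleR_ell2_def scaleC_ell2.rep_eq scaleR_conv_of_real)
qed (use ell2_component_le in \<open>simp_all add: plus_ell2.rep_eq\<close>)

lift_definition unit_ell2 :: "nat \<Rightarrow> ell2" is "\<lambda>m n. if n = m then 1 else 0"
  by (rule summable_finite[of "{_}"]) auto

lemma cinner_sums: "(\<lambda>n. Rep_ell2 x n * cnj (Rep_ell2 y n)) sums cinner x y"
  unfolding cinner_ell2.rep_eq
  by (intro summable_sums ell2_summable_mult ell2_summable)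

lemma cinner_unit_ell2 [simp]: "cinner x (unit_ell2 n) = Rep_ell2 x n"
proof -
  have "(\<lambda>k. Rep_ell2 x k * cnj (Rep_ell2 (unit_ell2 n) k)) sums (Rep_ell2 x n * cnj (Rep_ell2 (unit_ell2 n) n))"
    by (rule sums_finite[of "{n}", simplified]) (auto simp: unit_ell2.rep_eq)
  then show ?thesis
    using cinner_sums[of x "unit_ell2 n"] sums_unique2 by (fastforce simp: unit_ell2.rep_eq)
qed

lemma unit_ell2_cinner [simp]: "cinner (unit_ell2 n) x = cnj (Rep_ell2 x n)"
  by (metis cinner_commute cinner_unit_ell2)

lemma norm_unit_ell2 [simp]: "norm (unit_ell2 n) = 1"
proof -
  have "(norm (unit_ell2 n))\<^sup>2 = 1"
    using arg_cong[OF cinner_self[of "unit_ell2 n"], of Re] by (simp add: unit_ell2.rep_eq)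
  then show ?thesis using norm_ge_zero[of "unit_ell2 n"] by (simp only: power2_eq_1_iff) linarith
qed

lemma ell2_eqI: "(\<And>n. Rep_ell2 x n = Rep_ell2 y n) \<Longrightarrow> x = y"
  by (metis Rep_ell2_inject ext)

lemma finite_support_approx:
  fixes x :: ell2
  assumes "0 < e"
  obtains y N where "norm (x - y) < e" "\<And>n. N \<le> n \<Longrightarrow> Rep_ell2 y n = 0"
proof (rule ell2_dense[OF assms, of x])
  fix qs :: "(rat \<times> rat) list"
  let ?f = "\<lambda>n. if n < length qs then Complex (of_rat (fst (qs ! n))) (of_rat (snd (qs ! n))) else 0"
  have "summable (\<lambda>n. (cmod (?f n))\<^sup>2)"
    by (rule summable_finite[of "{..<length qs}"]) auto
  then have "Rep_ell2 (Abs_ell2 ?f) = ?f" by (simp add: Abs_ell2_inverse)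
  moreover assume "norm (x - Abs_ell2 ?f) < e"
  ultimately show thesis using that[of "Abs_ell2 ?f" "length qs"] by simp
qed

text \<open>Injectivity of \<open>j\<close> determines \<open>u\<close>, and two admissible values
  differ by a vector orthogonal to the dense range of \<open>j\<close>; hence the description in
  \<open>form_op\<close> denotes.\<close>

lemma form_op_eq:
  assumes "gelfand_triple j" "x \<in> form_dom j b"
  obtains u where "x = j u" "\<And>v. b u v = cinner (form_op j b x) (j v)"
proof -
  obtain u f where uf: "x = j u" "\<And>v. b u v = cinner f (j v)"
    using assms(2) unfolding form_dom_def by blast
  have "form_op j b x = f"
    unfolding form_op_def
  proof (rule the_equality)
    fix g assume "\<exists>u. x = j u \<and> (\<forall>v. b u v = cinner g (j v))"
    then have "\<forall>v. b u v = cinner g (j v)"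
      using uf(1) assms(1) by (auto simp: gelfand_triple_def inj_eq)
    then have "inner (g - f) (j v) = 0" for v
      using uf(2)[of v] by (simp add: inner_eq_Re_cinner cinner_diff_left)
    then have "closure (range j) \<subseteq> {y. inner (g - f) y = 0}"
      by (intro closure_minimal closed_Collect_eq continuous_intros) auto
    then have "g - f \<in> {y. inner (g - f) y = 0}"
      using assms(1) unfolding gelfand_triple_def by blast
    then show "g = f" by simp
  qed (use uf in blast)
  with uf that show thesis by blast
qed

section \<open>The oscillating form\<close>

definition weight :: "nat \<Rightarrow> complex" where
  "weight n = complex_of_real (1 / sqrt (2 ^ n))"

lemma weight_0 [simp]: "weight 0 = 1"
  by (simp add: weight_def)

lemma weight_nonzero [simp]: "weight n \<noteq> 0"
  by (simp add: weight_def)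

lemma cnj_weight [simp]: "cnj (weight n) = weight n"
  by (simp add: weight_def)

lemma norm_weight_sq: "(cmod (weight n))\<^sup>2 = (1 / 2) ^ n"
  by (simp add: weight_def norm_divide power_divide)

lemma weight_sq: "weight n * weight n = (1 / 2) ^ n"
proof -
  have "weight n * weight n = complex_of_real ((cmod (weight n))\<^sup>2)"
    by (simp only: complex_norm_square cnj_weight)
  then show ?thesis by (simp only: norm_weight_sq) simp
qed

lemma norm_weight_le: "cmod (weight n) \<le> 1"
  by (rule power2_le_imp_le) (simp_all add: norm_weight_sq power_le_one)

text \<open>Both \<open>V\<close> and \<open>H\<close> are represented by \<open>ell2\<close>, each
  in coordinates of an orthonormal basis of its own. The basis vectors of \<open>V\<close> are
  \<open>weight n\<close> times those of \<open>H\<close>, so the inclusion becomes a diagonal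
  map.\<close>

lift_definition embedding :: "ell2 \<Rightarrow> ell2" is "\<lambda>x n. weight n * x n"
proof -
  fix x :: "nat \<Rightarrow> complex" assume x: "summable (\<lambda>n. (cmod (x n))\<^sup>2)"
  have "norm ((cmod (weight n * x n))\<^sup>2) \<le> (cmod (x n))\<^sup>2" for n
    using mult_right_mono[OF power_mono[OF norm_weight_le[of n], of 2], of "(cmod (x n))\<^sup>2"]
    by (simp add: norm_mult power_mult_distrib)
  then show "summable (\<lambda>n. (cmod (weight n * x n))\<^sup>2)"
    by (intro summable_comparison_test'[OF x])
qed

lemma gelfand_triple_embedding: "gelfand_triple embedding"
  unfolding gelfand_triple_def
proof (intro conjI allI)
  show scaleC: "embedding (c *\<^sub>C x) = c *\<^sub>C embedding x" for c x by transfer auto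
  show "bounded_linear embedding"
  proof (rule bounded_linear_intro[where K = 1])
    show "embedding (x + y) = embedding x + embedding y" for x y
      by transfer (simp add: distrib_left)
    show "embedding (r *\<^sub>R x) = r *\<^sub>R embedding x" for r x
      by (simp add: scaleR_ell2_def scaleC)
    show "norm (embedding x) \<le> norm x * 1" for x
    proof (rule power2_le_imp_le)
      have "(cmod (Rep_ell2 (embedding x) n))\<^sup>2 \<le> (cmod (Rep_ell2 x n))\<^sup>2" for n
        using mult_right_mono[OF power_mono[OF norm_weight_le[of n], of 2], of "(cmod (Rep_ell2 x n))\<^sup>2"]
        by (simp add: embedding.rep_eq norm_mult power_mult_distrib)
      then show "(norm (embedding x))\<^sup>2 \<le> (norm x * 1)\<^sup>2"
        unfolding norm_ell2_sq mult_1_right by (intro suminf_le ell2_summable)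
    qed simp
  qed
  show "inj embedding"
  proof (rule injI, rule ell2_eqI)
    fix x y n assume "embedding x = embedding y"
    then have "Rep_ell2 (embedding x) n = Rep_ell2 (embedding y) n" by simp
    then show "Rep_ell2 x n = Rep_ell2 y n" by (simp add: embedding.rep_eq)
  qed
  have "x \<in> closure (range embedding)" for x
    unfolding closure_approachable
  proof (intro allI impI)
    fix e :: real assume "0 < e"
    then obtain y N where y: "norm (x - y) < e" "\<And>n. N \<le> n \<Longrightarrow> Rep_ell2 y n = 0"
      by (rule finite_support_approx[of e x]) blast
    \<comment> \<open>Dividing by the weights is harmless for finitely supported sequences, which
      are dense.\<close>
    define z where "z n = Rep_ell2 y n / weight n" for n
    have "summable (\<lambda>n. (cmod (z n))\<^sup>2)"
      by (rule summable_finite[of "{..<N}"]) (auto simp: z_def y(2))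
    then have z: "Rep_ell2 (Abs_ell2 z) = z" by (simp add: Abs_ell2_inverse)
    have "embedding (Abs_ell2 z) = y"
      by (rule ell2_eqI) (simp add: embedding.rep_eq z z_def)
    then show "\<exists>y\<in>range embedding. dist y x < e"
      using y(1) by (metis dist_norm norm_minus_commute rangeI)
  qed
  then show "closure (range embedding) = UNIV" by blast
qed

section \<open>The oscillating coupling vector and its Hoelder continuity\<close>

definition wave :: "nat \<Rightarrow> real \<Rightarrow> complex" where
  "wave n t = (if n = 0 then 0 else cis (2 ^ n * t))"

text \<open>The default value at index 0 keeps coordinate 0 from coupling to itself while letting
  all series run over every index.\<close>

lemma wave_0 [simp]: "wave 0 t = 0"
  by (simp add: wave_def)

lemma norm_wave: "0 < n \<Longrightarrow> cmod (wave n t) = 1"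
  by (simp add: wave_def)

lemma norm_wave_le: "cmod (wave n t) \<le> 1"
  by (simp add: wave_def)

lemma wave_mult_cnj: "0 < n \<Longrightarrow> wave n t * cnj (wave n t) = 1"
  by (simp add: wave_def cis_cnj cis_mult)

lemma continuous_on_wave [continuous_intros]: "continuous_on S (wave n)"
  unfolding wave_def[abs_def] by (cases "n = 0") (auto intro!: continuous_intros)

lemma has_vector_derivative_wave:
  "(wave n has_vector_derivative 2 ^ n * \<i> * wave n t) (at t)"
proof (cases "n = 0")
  case False
  have "((\<lambda>t. cis (2 ^ n * t)) has_vector_derivative 2 ^ n *\<^sub>R (\<i> * cis (2 ^ n * t))) (at t)"
    unfolding has_vector_derivative_def
    by (rule has_derivative_eq_rhs, rule derivative_intros, rule derivative_intros, rule derivative_intros)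
       (simp add: scaleR_conv_of_real mult_ac)
  with False show ?thesis by (simp add: wave_def[abs_def] scaleR_conv_of_real mult_ac)
qed (simp add: wave_def[abs_def])

lemma norm_wave_diff_le: "cmod (wave n t - wave n s) \<le> 2 ^ n * \<bar>t - s\<bar>"
proof -
  have "cmod (wave n t - wave n s) \<le> 2 ^ n * norm (t - s)"
  proof (rule differentiable_bound[where S = UNIV])
    show "(wave n has_derivative (\<lambda>h. h *\<^sub>R (2 ^ n * \<i> * wave n x))) (at x within UNIV)" for x
      using has_vector_derivative_wave[of n x] by (simp add: has_vector_derivative_def)
    show "onorm (\<lambda>h. h *\<^sub>R (2 ^ n * \<i> * wave n x)) \<le> 2 ^ n" for x
      using norm_wave_le[of n x] by (intro onorm_le) (simp add: norm_mult norm_power mult_left_le mult_mono mult.commute)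
  qed auto
  then show ?thesis by simp
qed

lift_definition oscillation :: "real \<Rightarrow> ell2" is "\<lambda>t n. weight n * wave n t"
proof (rule summable_comparison_test')
  show "summable (\<lambda>n. (1 / 2 :: real) ^ n)" by (simp add: summable_geometric)
  show "norm ((cmod (weight n * wave n t))\<^sup>2) \<le> (1 / 2) ^ n" for n t
    using mult_left_mono[OF power_mono[OF norm_wave_le[of n t], of 2], of "(1 / 2) ^ n"]
    by (simp add: norm_mult power_mult_distrib norm_weight_sq)
qed

lemma norm_oscillation_le: "norm (oscillation t) \<le> 1"
proof (rule power2_le_imp_le)
  have "(\<lambda>n. (cmod (Rep_ell2 (oscillation t) (Suc n)))\<^sup>2) sums 1"
    using power_half_series by (simp add: oscillation.rep_eq norm_mult power_mult_distrib norm_weight_sq norm_wave)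
  then have "(\<lambda>n. (cmod (Rep_ell2 (oscillation t) n))\<^sup>2) sums 1"
    by (subst (asm) sums_Suc_iff) (simp add: oscillation.rep_eq)
  then show "(norm (oscillation t))\<^sup>2 \<le> 1\<^sup>2"
    by (simp add: norm_ell2_sq sums_iff)
qed simp

text \<open>
  With \<open>x = 2 ^ n * h\<close> the right-hand side is a difference of consecutive values in \<open>n\<close>, so that the
  sum of the left-hand sides weighted by \<open>2 ^ (-n)\<close> telescopes to a multiple of \<open>h\<close>. Summing the two
  estimates of \<open>d\<close> separately would lose a logarithm.
\<close>

lemma min_square_le:
  fixes x :: real
  assumes "0 \<le> x" "d \<le> 2" "d \<le> x" "0 \<le> d"
  shows "d\<^sup>2 \<le> 15 * x * (2 * x / (1 + 2 * x) - x / (1 + x))"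
proof -
  have eq: "15 * x * (2 * x / (1 + 2 * x) - x / (1 + x)) = 15 * x\<^sup>2 / ((1 + 2 * x) * (1 + x))"
    using assms(1) by (simp add: divide_simps power2_eq_square) (simp add: algebra_simps)
  \<comment> \<open>Expanding the product as 1 + 3 x + 2 x^2, the three terms contribute at most 1,
    3 times 2, and 2 times 4 multiples of x^2, which add up to 15.\<close>
  have "d\<^sup>2 * ((1 + 2 * x) * (1 + x)) \<le> 15 * x\<^sup>2"
  proof -
    have "d\<^sup>2 \<le> x\<^sup>2" "d\<^sup>2 \<le> 4" "d * d * x \<le> x * 2 * x" using assms
      by (auto intro!: mult_mono power_mono[of d x 2] power_mono[of d 2 2, simplified])
    moreover have "d\<^sup>2 * x\<^sup>2 \<le> 4 * x\<^sup>2" using \<open>d\<^sup>2 \<le> 4\<close> by (intro mult_right_mono) auto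
    ultimately show ?thesis by (simp add: power2_eq_square algebra_simps)
  qed
  then show ?thesis unfolding eq using assms(1) by (simp add: pos_le_divide_eq)
qed

lemma norm_oscillation_diff_sq_le: "(norm (oscillation t - oscillation s))\<^sup>2 \<le> 15 * \<bar>t - s\<bar>"
proof -
  define h where "h = \<bar>t - s\<bar>"
  define F where "F n = 2 ^ n * h / (1 + 2 ^ n * h)" for n
  have h: "0 \<le> h" by (simp add: h_def)
  have F: "0 \<le> F n" "F n \<le> 1" for n
  proof -
    have "0 \<le> 2 ^ n * h" using h by simp
    then show "0 \<le> F n" "F n \<le> 1" by (simp_all add: F_def add_nonneg_nonneg divide_le_eq_1)
  qed
  have term_le: "(cmod (Rep_ell2 (oscillation t - oscillation s) n))\<^sup>2 \<le> 15 * h * (F (Suc n) - F n)" for n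
  proof -
    have "cmod (wave n t - wave n s) \<le> 2"
      using norm_triangle_ineq4[of "wave n t" "wave n s"] norm_wave_le[of n t] norm_wave_le[of n s] by linarith
    then have "(cmod (wave n t - wave n s))\<^sup>2 \<le> 15 * (2 ^ n * h) * (2 * (2 ^ n * h) / (1 + 2 * (2 ^ n * h)) - 2 ^ n * h / (1 + 2 ^ n * h))"
      using h norm_wave_diff_le[of n t s] by (intro min_square_le) (auto simp: h_def)
    then have "(1 / 2) ^ n * (cmod (wave n t - wave n s))\<^sup>2 \<le> (1 / 2) ^ n * (15 * (2 ^ n * h) * (F (Suc n) - F n))"
      by (intro mult_left_mono) (simp_all add: F_def mult.assoc)
    moreover have "(1 / 2) ^ n * (15 * (2 ^ n * h) * (F (Suc n) - F n)) = 15 * h * (F (Suc n) - F n)"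
      by (simp add: power_one_over)
    ultimately show ?thesis
      by (simp add: minus_ell2.rep_eq oscillation.rep_eq norm_mult power_mult_distrib norm_weight_sq
          flip: right_diff_distrib)
  qed
  have "(\<Sum>n<N. (cmod (Rep_ell2 (oscillation t - oscillation s) n))\<^sup>2) \<le> 15 * h" for N
  proof -
    have "(\<Sum>n<N. (cmod (Rep_ell2 (oscillation t - oscillation s) n))\<^sup>2) \<le> (\<Sum>n<N. 15 * h * (F (Suc n) - F n))"
      by (intro sum_mono term_le)
    also have "\<dots> = 15 * h * (F N - F 0)"
      by (simp only: sum_distrib_left[symmetric] sum_lessThan_telescope)
    also have "\<dots> \<le> 15 * h * 1"
      using F[of N] F[of 0] h by (intro mult_left_mono) auto
    finally show ?thesis by simp
  qed
  then show ?thesis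
    unfolding norm_ell2_sq h_def[symmetric] by (intro suminf_le_const ell2_summable)
qed

lemma norm_oscillation_diff_le: "norm (oscillation t - oscillation s) \<le> 4 * \<bar>t - s\<bar> powr (1 / 2)"
proof (rule power2_le_imp_le)
  have "(4 * \<bar>t - s\<bar> powr (1 / 2))\<^sup>2 = 16 * \<bar>t - s\<bar>"
    by (simp add: powr_half_sqrt power_mult_distrib)
  then show "(norm (oscillation t - oscillation s))\<^sup>2 \<le> (4 * \<bar>t - s\<bar> powr (1 / 2))\<^sup>2"
    using order_trans[OF norm_oscillation_diff_sq_le[of t s], of "16 * \<bar>t - s\<bar>"] by simp
qed simp

lemma continuous_on_oscillation [continuous_intros]: "continuous_on S oscillation"
proof -
  have "isCont oscillation s" for s
    unfolding isCont_def
  proof (rule Lim_null[THEN iffD2], rule Lim_null_comparison)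
    show "\<forall>\<^sub>F t in at s. norm (oscillation t - oscillation s) \<le> 4 * \<bar>t - s\<bar> powr (1 / 2)"
      by (intro always_eventually allI norm_oscillation_diff_le)
    show "((\<lambda>t. 4 * \<bar>t - s\<bar> powr (1 / 2)) \<longlongrightarrow> 0) (at s)"
      unfolding powr_half_sqrt[OF abs_ge_zero] by (rule tendsto_eq_intros refl | simp)+
  qed
  then show ?thesis by (simp add: continuous_at_imp_continuous_on)
qed

text \<open>Chosen so that \<open>coupling * wave n t * t\<close> cancels the two terms of order
  \<open>t\<close> that the explicit solution leaves in coordinate n > 0: \<i> t / 8 from
  differentiating the wave and t / 8 from the factor \<open>2 ^ n\<close> of the operator.\<close>

definition coupling :: complex where
  "coupling = - (1 + \<i>) / 8"

lemma norm_coupling_le: "cmod coupling \<le> 1 / 4"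
  by (rule power2_le_imp_le)
     (simp_all add: coupling_def norm_divide power_divide cmod_power2 norm_minus_commute del: minus_add_distrib)

text \<open>The inner product of \<open>V\<close> plus a Hermitian perturbation of rank at most
  two.\<close>

definition form :: "real \<Rightarrow> ell2 \<Rightarrow> ell2 \<Rightarrow> complex" where
  "form t u v = cinner u v
     + cinner u (unit_ell2 0) * cinner (coupling *\<^sub>C oscillation t) v
     + cinner u (coupling *\<^sub>C oscillation t) * cinner (unit_ell2 0) v"

text \<open>The residual of the explicit solution, in coordinates of \<open>V\<close>. In coordinate
  0 the summands are the derivative, the identity part and the coupling series; in the others only
  the derivative of the amplitude survives, and its factor \<open>(1 / 2) ^ n\<close> is what places
  the forcing in \<open>V\<close>.\<close>

definition forcing :: "real \<Rightarrow> ell2" where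
  "forcing t = (1 + t + cnj coupling * t / 8) *\<^sub>C unit_ell2 0 + (1 / 8) *\<^sub>C oscillation t"

text \<open>
  The coordinates in \<open>H\<close> of the solution for \<^const>\<open>forcing\<close>. They are kept separate, since
  differentiability is only available coordinatewise.
\<close>

definition solution :: "nat \<Rightarrow> real \<Rightarrow> complex" where
  "solution n t = (if n = 0 then of_real t else t / 8 * (1 / 2) ^ n * wave n t)"

section \<open>Boundedness, coercivity and Hoelder continuity of the form\<close>

lemma norm_coupling_oscillation_le: "norm (coupling *\<^sub>C oscillation t) \<le> 1 / 4"
  using mult_mono[OF norm_coupling_le norm_oscillation_le[of t]] by (simp add: norm_scaleC)

lemma sesquilinear_form: "sesquilinear (form t)"
  unfolding sesquilinear_def form_def
  by (simp only: cinner_add_left cinner_add_right cinner_scaleC_left cinner_scaleC_right) (simp add: algebra_simps)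

lemma form_commute: "form t u v = cnj (form t v u)"
  unfolding form_def complex_cnj_add complex_cnj_mult
  by (simp only: cinner_commute[symmetric] ac_simps)

lemma norm_rank_two_le:
  fixes u v x y :: "'a::complex_inner"
  shows "cmod (cinner u x * cinner y v + cinner u y * cinner x v) \<le> 2 * norm x * norm y * norm u * norm v"
proof -
  have "cmod (cinner u x * cinner y v + cinner u y * cinner x v)
      \<le> (norm u * norm x) * (norm y * norm v) + (norm u * norm y) * (norm x * norm v)"
    by (rule order_trans[OF norm_triangle_ineq]; unfold norm_mult)
       (intro add_mono mult_mono cmod_cinner_le; simp)
  then show ?thesis by (simp add: mult_ac)
qed

text \<open>The perturbation has norm at most 2 * 1 * 1/4. As this is smaller than 1, coercivity of
  the inner product survives.\<close>

lemma norm_form_minus_cinner_le: "cmod (form t u v - cinner u v) \<le> 1 / 2 * norm u * norm v"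
proof -
  have "cmod (form t u v - cinner u v) \<le> 2 * norm (unit_ell2 0) * norm (coupling *\<^sub>C oscillation t) * norm u * norm v"
    using norm_rank_two_le[of u "unit_ell2 0" "coupling *\<^sub>C oscillation t" v] by (simp add: form_def add.assoc)
  also have "\<dots> \<le> 2 * 1 * (1 / 4) * norm u * norm v"
    using norm_coupling_oscillation_le[of t] by (intro mult_mono) auto
  finally show ?thesis by simp
qed

lemma norm_form_le: "cmod (form t u v) \<le> 2 * norm u * norm v"
proof -
  have "cmod (form t u v) \<le> cmod (cinner u v) + cmod (form t u v - cinner u v)"
    using norm_triangle_ineq[of "cinner u v" "form t u v - cinner u v"] by simp
  also have "\<dots> \<le> norm u * norm v + 1 / 2 * norm u * norm v"
    by (intro add_mono cmod_cinner_le norm_form_minus_cinner_le)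
  also have "\<dots> \<le> 2 * norm u * norm v" by simp
  finally show ?thesis .
qed

lemma form_coercive: "1 / 2 * (norm u)\<^sup>2 \<le> Re (form t u u)"
proof -
  have "- Re (form t u u - cinner u u) \<le> 1 / 2 * (norm u)\<^sup>2"
    using norm_form_minus_cinner_le[of t u u] abs_Re_le_cmod[of "form t u u - cinner u u"]
    by (simp add: power2_eq_square)
  then show ?thesis by (simp add: cinner_self)
qed

lemma norm_form_diff_le:
  "cmod (form t u v - form s u v) \<le> 2 * \<bar>t - s\<bar> powr (1 / 2) * norm u * norm v"
proof -
  let ?d = "coupling *\<^sub>C (oscillation t - oscillation s)"
  have "cmod (form t u v - form s u v) \<le> 2 * norm (unit_ell2 0) * norm ?d * norm u * norm v"
    using norm_rank_two_le[of u "unit_ell2 0" ?d v]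
    by (simp add: form_def cinner_scaleC_left cinner_scaleC_right cinner_diff_left cinner_diff_right algebra_simps)
  \<comment> \<open>The bound 1/4 of the coupling cancels the Hoelder constant 4 of the
    oscillation.\<close>
  also have "norm ?d \<le> 1 / 4 * (4 * \<bar>t - s\<bar> powr (1 / 2))"
    unfolding norm_scaleC by (intro mult_mono norm_coupling_le norm_oscillation_diff_le) auto
  finally show ?thesis by (simp add: mult_left_mono mult_right_mono)
qed

section \<open>The evolution equation in coordinates\<close>

lemma Rep_embedding_forcing:
  "Rep_ell2 (embedding (forcing t)) n
     = (if n = 0 then 1 + t + cnj coupling * t / 8 else (1 / 2) ^ n * wave n t / 8)"
  by (simp add: embedding.rep_eq forcing_def plus_ell2.rep_eq scaleC_ell2.rep_eq unit_ell2.rep_eq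
      oscillation.rep_eq mult.assoc[symmetric] weight_sq)

lemma continuous_forcing: "continuous_on S forcing"
  unfolding forcing_def[abs_def]
  by (intro continuous_on_add continuous_on_scaleC_left continuous_on_scaleC_right continuous_intros) simp_all

text \<open>Obtained by testing with unit vectors of \<open>V\<close>. Passing to coordinates of
  \<open>H\<close> turns the identity form into multiplication by \<open>2 ^ n\<close> and absorbs
  the weights of the oscillation.\<close>

lemma form_op_components:
  assumes "x \<in> form_dom embedding (form t)"
  shows "0 < n \<Longrightarrow> Rep_ell2 (form_op embedding (form t) x) n
      = 2 ^ n * Rep_ell2 x n + coupling * wave n t * Rep_ell2 x 0"
    and "(\<lambda>n. cnj coupling * cnj (wave n t) * Rep_ell2 x n) sums
      (Rep_ell2 (form_op embedding (form t) x) 0 - Rep_ell2 x 0)"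
proof -
  let ?F = "form_op embedding (form t) x"
  obtain u where u: "x = embedding u" "\<And>v. form t u v = cinner ?F (embedding v)"
    using form_op_eq[OF gelfand_triple_embedding assms] by blast
  have x: "Rep_ell2 x n = weight n * Rep_ell2 u n" for n
    by (simp add: u(1) embedding.rep_eq)
  have "embedding (unit_ell2 n) = weight n *\<^sub>C unit_ell2 n" for n
    by (rule ell2_eqI) (simp add: embedding.rep_eq scaleC_ell2.rep_eq unit_ell2.rep_eq)
  then have F: "weight n * Rep_ell2 ?F n = form t u (unit_ell2 n)" for n
    by (simp add: u(2) cinner_scaleC_right)
  show "Rep_ell2 ?F n = 2 ^ n * Rep_ell2 x n + coupling * wave n t * Rep_ell2 x 0" if "0 < n"
  proof -
    have w: "weight n * weight n * 2 ^ n = 1" by (simp add: weight_sq power_one_over)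
    have "weight n * Rep_ell2 ?F n = Rep_ell2 u n + Rep_ell2 u 0 * coupling * weight n * wave n t"
      using that by (simp add: F form_def unit_ell2.rep_eq scaleC_ell2.rep_eq oscillation.rep_eq)
    also have "\<dots> = weight n * (2 ^ n * Rep_ell2 x n + coupling * wave n t * Rep_ell2 x 0)"
      using w by (simp add: x algebra_simps)
    finally show ?thesis by simp
  qed
  have "Rep_ell2 ?F 0 - Rep_ell2 x 0 = cinner u (coupling *\<^sub>C oscillation t)"
    using F[of 0] by (simp add: x form_def unit_ell2.rep_eq scaleC_ell2.rep_eq oscillation.rep_eq)
  moreover have "Rep_ell2 u n * cnj (Rep_ell2 (coupling *\<^sub>C oscillation t) n) = cnj coupling * cnj (wave n t) * Rep_ell2 x n" for n
    by (simp add: x scaleC_ell2.rep_eq oscillation.rep_eq)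
  ultimately show "(\<lambda>n. cnj coupling * cnj (wave n t) * Rep_ell2 x n) sums (Rep_ell2 ?F 0 - Rep_ell2 x 0)"
    using cinner_sums[of u "coupling *\<^sub>C oscillation t"] by simp
qed

lemma has_vector_derivative_solution:
  "(solution n has_vector_derivative (if n = 0 then 1 else wave n t / 8 * ((1 / 2) ^ n + \<i> * t))) (at t)"
proof (cases "n = 0")
  case True
  then show ?thesis
    using has_vector_derivative_of_real[OF DERIV_ident] by (simp add: solution_def[abs_def])
next
  case False
  have "((\<lambda>t. t *\<^sub>R ((1 / 2) ^ n / 8 * wave n t)) has_vector_derivative
      t *\<^sub>R ((1 / 2) ^ n / 8 * (2 ^ n * \<i> * wave n t)) + 1 *\<^sub>R ((1 / 2) ^ n / 8 * wave n t)) (at t)"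
    by (intro has_vector_derivative_scaleR has_vector_derivative_mult_right has_vector_derivative_wave DERIV_ident)
  moreover have "solution n = (\<lambda>t. t *\<^sub>R ((1 / 2) ^ n / 8 * wave n t))"
    using False by (simp add: solution_def fun_eq_iff scaleR_conv_of_real)
  moreover have "t *\<^sub>R ((1 / 2) ^ n / 8 * (2 ^ n * \<i> * wave n t)) + 1 *\<^sub>R ((1 / 2) ^ n / 8 * wave n t)
      = wave n t / 8 * ((1 / 2) ^ n + \<i> * t)"
    by (simp add: scaleR_conv_of_real power_one_over field_simps)
  ultimately show ?thesis using False by (simp only: if_False)
qed

lemma continuous_solution: "continuous_on S (solution n)"
  using has_vector_derivative_solution has_vector_derivative_continuous
  by (blast intro: continuous_at_imp_continuous_on)

text \<open>The phases of wave and solution cancel, leaving the geometric series of 1/2 from index 1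
  on.\<close>

lemma solution_sums:
  "(\<lambda>n. cnj coupling * cnj (wave n t) * solution n t) sums (cnj coupling * t / 8)"
proof -
  have "(\<lambda>n. (1 / 2) ^ Suc n :: complex) sums 1"
    using sums_of_real[OF power_half_series, where 'a = complex] by simp
  then have "(\<lambda>n. cnj coupling * t / 8 * (1 / 2) ^ Suc n) sums (cnj coupling * t / 8 * 1)"
    by (rule sums_mult)
  moreover have eq: "cnj coupling * t / 8 * (1 / 2) ^ Suc n = cnj coupling * cnj (wave (Suc n) t) * solution (Suc n) t" for n
    using wave_mult_cnj[of "Suc n" t] by (simp add: solution_def mult_ac)
  ultimately have "(\<lambda>n. cnj coupling * cnj (wave (Suc n) t) * solution (Suc n) t) sums (cnj coupling * t / 8)"
    unfolding eq by simp
  then show ?thesis by (subst (asm) sums_Suc_iff) simp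
qed

text \<open>With the integrating factor exp(\<mu> s) the damping term disappears, and the remaining
  derivative is dominated by that of H / \<mu> * exp(\<mu> s).\<close>

lemma damped_bound:
  fixes D h :: "real \<Rightarrow> complex"
  assumes D: "continuous_on {0..T} D" "D 0 = 0" and \<mu>: "0 < \<mu>"
    and D': "\<And>t. 0 < t \<Longrightarrow> t < T \<Longrightarrow> (D has_vector_derivative - (of_real \<mu> * D t) + h t) (at t)"
    and h: "\<And>t. 0 < t \<Longrightarrow> t < T \<Longrightarrow> cmod (h t) \<le> H" and "0 \<le> H"
    and t: "t \<in> {0..T}"
  shows "cmod (D t) \<le> H / \<mu>"
proof (cases "t = 0")
  case True
  then show ?thesis using D \<mu> \<open>0 \<le> H\<close> by simp
next
  case False
  have ex: "((\<lambda>s. exp (\<mu> * s)) has_real_derivative \<mu> * exp (\<mu> * s)) (at s)" for s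
    by (auto intro!: derivative_eq_intros)
  have "norm (exp (\<mu> * t) *\<^sub>R D t - exp (\<mu> * 0) *\<^sub>R D 0) \<le> H / \<mu> * exp (\<mu> * t) - H / \<mu> * exp (\<mu> * 0)"
  proof (rule differentiable_bound_general)
    show "0 < t" using False t by simp
    show "continuous_on {0..t} (\<lambda>s. exp (\<mu> * s) *\<^sub>R D s)"
      using t by (intro continuous_intros continuous_on_subset[OF D(1)]) auto
    show "continuous_on {0..t} (\<lambda>s. H / \<mu> * exp (\<mu> * s))"
      by (intro continuous_intros)
    fix s assume s: "0 < s" "s < t"
    have "((\<lambda>s. exp (\<mu> * s) *\<^sub>R D s) has_vector_derivative
        exp (\<mu> * s) *\<^sub>R (- (of_real \<mu> * D s) + h s) + (\<mu> * exp (\<mu> * s)) *\<^sub>R D s) (at s)"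
      using s t by (intro has_vector_derivative_scaleR D' ex) auto
    then show "((\<lambda>s. exp (\<mu> * s) *\<^sub>R D s) has_vector_derivative exp (\<mu> * s) *\<^sub>R h s) (at s)"
      by (simp add: scaleR_conv_of_real algebra_simps)
    show "((\<lambda>s. H / \<mu> * exp (\<mu> * s)) has_vector_derivative H * exp (\<mu> * s)) (at s)"
      using DERIV_cmult[OF ex, of "H / \<mu>" s] \<mu> by (simp add: has_real_derivative_iff_has_vector_derivative)
    show "norm (exp (\<mu> * s) *\<^sub>R h s) \<le> H * exp (\<mu> * s)"
      using h[of s] s t by (simp add: mult.commute)
  qed
  then have "exp (\<mu> * t) * cmod (D t) \<le> exp (\<mu> * t) * (H / \<mu>) - H / \<mu>"
    by (simp add: D(2) mult.commute)
  then have "exp (\<mu> * t) * cmod (D t) \<le> exp (\<mu> * t) * (H / \<mu>)"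
    using divide_nonneg_pos[OF \<open>0 \<le> H\<close> \<mu>] by linarith
  then show ?thesis by (simp only: mult_le_cancel_left_pos exp_gt_zero)
qed

text \<open>The bracket has imaginary part \<open>t\<close>, so these coordinates do not tend to
  zero.\<close>

lemma not_summable_derivative:
  assumes "0 < t" and x: "\<And>n. 0 < n \<Longrightarrow> Rep_ell2 x n = wave n t / 8 * ((1 / 2) ^ n + \<i> * t)"
  shows False
proof -
  have "\<forall>\<^sub>F n in sequentially. (cmod (Rep_ell2 x n))\<^sup>2 < (t / 8)\<^sup>2"
    by (rule order_tendstoD(2)[OF summable_LIMSEQ_zero[OF ell2_summable]]) (use assms(1) in simp)
  then obtain N where "\<And>n. N \<le> n \<Longrightarrow> (cmod (Rep_ell2 x n))\<^sup>2 < (t / 8)\<^sup>2"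
    unfolding eventually_sequentially by blast
  from this[of "Suc N"] obtain n where n: "0 < n" "(cmod (Rep_ell2 x n))\<^sup>2 < (t / 8)\<^sup>2"
    by (blast intro: le_SucI order_refl zero_less_Suc)
  have "(1 / 2) ^ n = complex_of_real ((1 / 2) ^ n)" by simp
  then have "Im ((1 / 2) ^ n + \<i> * t) = t"
    by (simp only: plus_complex.sel Im_complex_of_real Im_i_times Re_complex_of_real add_0)
  then have "t \<le> cmod ((1 / 2) ^ n + \<i> * t)"
    using abs_Im_le_cmod[of "(1 / 2) ^ n + \<i> * t"] assms(1) by simp
  then have "t / 8 \<le> cmod (Rep_ell2 x n)"
    using n(1) by (simp add: x norm_mult norm_divide norm_wave)
  then have "(t / 8)\<^sup>2 \<le> (cmod (Rep_ell2 x n))\<^sup>2"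
    using assms(1) by (intro power_mono) auto
  with n(2) show False by simp
qed

section \<open>Uniqueness and failure of maximal regularity\<close>

text \<open>
  The series in the equation for \<open>D 0\<close> enters through its sum \<open>h\<close>, whose continuity only follows from
  the decay of the \<open>D n\<close> established in the proof.
\<close>

lemma difference_vanishes:
  fixes D :: "nat \<Rightarrow> real \<Rightarrow> complex"
  assumes cont: "\<And>n. continuous_on {0..T} (D n)" and zero: "\<And>n. D n 0 = 0" and "0 \<le> T"
    and D': "\<And>n t. 0 < n \<Longrightarrow> 0 < t \<Longrightarrow> t < T \<Longrightarrow>
      (D n has_vector_derivative - (2 ^ n * D n t) - coupling * wave n t * D 0 t) (at t)"
    and D0': "\<And>h t. continuous_on {0..T} h \<Longrightarrow>
      (\<And>s. s \<in> {0..T} \<Longrightarrow> (\<lambda>n. cnj coupling * cnj (wave n s) * D n s) sums h s) \<Longrightarrow>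
      0 < t \<Longrightarrow> t < T \<Longrightarrow> (D 0 has_vector_derivative - D 0 t - h t) (at t)"
    and t: "t \<in> {0..T}"
  shows "D n t = 0"
proof -
  \<comment> \<open>The maximum of coordinate 0 will be shown to be at most an eighth of
    itself.\<close>
  obtain s where s: "s \<in> {0..T}" and max: "\<And>t. t \<in> {0..T} \<Longrightarrow> cmod (D 0 t) \<le> cmod (D 0 s)"
    using continuous_attains_sup[OF _ _ continuous_on_norm[OF cont[of 0]]] \<open>0 \<le> T\<close>
    by (metis atLeastAtMost_iff compact_Icc empty_iff order_refl)
  define S where "S = cmod (D 0 s)"
  have S: "0 \<le> S" by (simp add: S_def)
  have coupling_wave: "cmod (coupling * wave n t) \<le> 1 / 4" for n t
    using mult_mono[OF norm_coupling_le norm_wave_le[of n t]] by (simp add: norm_mult)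
  \<comment> \<open>Coordinate \<open>n\<close> is damped at rate \<open>2 ^ n\<close> and driven by
    a term of modulus at most S / 4.\<close>
  have Dn: "cmod (D n t) \<le> S / 4 / 2 ^ n" if "0 < n" "t \<in> {0..T}" for n t
  proof (rule damped_bound[OF cont[of n] zero, where h = "\<lambda>t. - (coupling * wave n t * D 0 t)"])
    show "(D n has_vector_derivative - (complex_of_real (2 ^ n) * D n t) + - (coupling * wave n t * D 0 t)) (at t)"
      if "0 < t" "t < T" for t using D'[OF \<open>0 < n\<close> that] by simp
    show "cmod (- (coupling * wave n t * D 0 t)) \<le> S / 4" if "0 < t" "t < T" for t
      using mult_mono[OF coupling_wave max, of t n t] that S by (simp add: norm_mult S_def)
  qed (use that S in auto)
  define h where "h t = (\<Sum>n. cnj coupling * cnj (wave n t) * D n t)" for t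
  \<comment> \<open>The second factor 1/4 comes from the coupling back into coordinate 0; at index 0
    the term vanishes with the wave.\<close>
  have term_le: "cmod (cnj coupling * cnj (wave n t) * D n t) \<le> S / 16 * (1 / 2) ^ n" if "t \<in> {0..T}" for n t
  proof (cases "n = 0")
    case False
    have "cmod (coupling * wave n t) * cmod (D n t) \<le> 1 / 4 * (S / 4 / 2 ^ n)"
      using False that coupling_wave[of n t] Dn[of n t] by (intro mult_mono) auto
    then show ?thesis by (simp add: norm_mult power_one_over)
  qed (simp add: S)
  have summ: "summable (\<lambda>n. S / 16 * (1 / 2) ^ n)" by (intro summable_mult summable_geometric) simp
  have sums: "(\<lambda>n. cnj coupling * cnj (wave n t) * D n t) sums h t" if "t \<in> {0..T}" for t
    unfolding h_def by (intro summable_sums summable_comparison_test'[OF summ term_le[OF that]])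
  have "continuous_on {0..T} h"
    unfolding h_def[abs_def]
  proof (rule uniform_limit_theorem)
    show "uniform_limit {0..T} (\<lambda>N t. \<Sum>n<N. cnj coupling * cnj (wave n t) * D n t)
        (\<lambda>t. \<Sum>n. cnj coupling * cnj (wave n t) * D n t) sequentially"
      by (rule Weierstrass_m_test[OF term_le summ])
    show "\<forall>\<^sub>F N in sequentially. continuous_on {0..T} (\<lambda>t. \<Sum>n<N. cnj coupling * cnj (wave n t) * D n t)"
      by (intro always_eventually allI continuous_intros cont)
  qed simp
  note D0'' = D0'[OF this sums]
  have "cmod (h t) \<le> S / 8" if "t \<in> {0..T}" for t
  proof -
    have "(\<lambda>n. S / 16 * (1 / 2) ^ n) sums (S / 16 * (1 / (1 - 1 / 2)))"
      by (intro sums_mult geometric_sums) simp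
    then have "(\<Sum>n. S / 16 * (1 / 2) ^ n) = S / 8" by (simp add: sums_iff)
    then show ?thesis
      unfolding h_def using norm_suminf_le[OF term_le[OF that] summ] by simp
  qed
  \<comment> \<open>Coordinate 0 is damped at rate 1, which closes the circle: S \<le> S /
    8.\<close>
  then have "cmod (D 0 s) \<le> S / 8 / 1"
    using D0'' s S by (intro damped_bound[OF cont[of 0] zero, where h = "\<lambda>t. - h t"]) auto
  then have "S = 0" using S by (simp add: S_def)
  then show ?thesis
    using max[OF t] Dn[OF _ t, of n] by (cases "n = 0") (simp_all add: S_def)
qed

text \<open>It is existence that fails: any candidate must have the coordinates of the explicit
  solution, whose derivative leaves \<open>H\<close>.\<close>

lemma no_MR2_solution:
  assumes T: "0 < T"
  shows "\<not> MR2_solution T embedding form (\<lambda>t. embedding (forcing t)) 0 w"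
proof
  let ?L = "lebesgue_on {0..T}"
  assume "MR2_solution T embedding form (\<lambda>t. embedding (forcing t)) 0 w"
  then obtain w' W where w: "w \<in> L2 T" and w': "w' \<in> L2 T" and wd: "weak_deriv T w w'"
    and dom: "AE t in ?L. w t \<in> form_dom embedding (form t)"
    and eq: "AE t in ?L. w' t + form_op embedding (form t) (w t) = embedding (forcing t)"
    and W: "continuous_on {0..T} W" "AE t in ?L. W t = w t" "W 0 = 0"
    unfolding MR2_solution_def MR2_def H1_def initial_value_def by blast
  \<comment> \<open>The equation solved for the coordinates of \<open>w'\<close>, with
    \<open>w\<close> replaced by its continuous representative. Coordinate 0 is stated as the sum of
    its coupling series.\<close>
  have w'_comp: "AE t in ?L. W t = w t \<and>
      (\<forall>n>0. Rep_ell2 (w' t) n = (1 / 2) ^ n * wave n t / 8 - 2 ^ n * Rep_ell2 (W t) n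
        - coupling * wave n t * Rep_ell2 (W t) 0) \<and>
      (\<lambda>n. cnj coupling * cnj (wave n t) * Rep_ell2 (W t) n) sums
        (1 + t + cnj coupling * t / 8 - Rep_ell2 (w' t) 0 - Rep_ell2 (W t) 0)"
    using dom eq W(2)
  proof eventually_elim
    case (elim t)
    have F: "Rep_ell2 (form_op embedding (form t) (w t)) n = Rep_ell2 (embedding (forcing t)) n - Rep_ell2 (w' t) n" for n
      by (simp add: plus_ell2.rep_eq flip: elim(2))
    show ?case
      using form_op_components[OF elim(1)] elim(3)
      by (auto simp: F Rep_embedding_forcing algebra_simps eq_diff_eq)
  qed
  define V where "V n t = Rep_ell2 (W t) n" for n t
  have V: "continuous_on {0..T} (V n)" for n
    unfolding V_def[abs_def] by (intro bounded_linear.continuous_on[OF bounded_linear_Rep_ell2] W)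
  \<comment> \<open>A coordinate of \<open>W\<close> is classically differentiable as soon as that
    of \<open>w'\<close> agrees almost everywhere with a continuous function.\<close>
  have V': "(V n has_vector_derivative g t) (at t)"
    if g: "continuous_on {0..T} g" "AE t in ?L. Rep_ell2 (w' t) n = g t" and t: "0 < t" "t < T" for n g t
  proof (rule weak_deriv_imp_has_vector_derivative[OF _ V g(1) t])
    have meas: "(\<lambda>t. Rep_ell2 (u t) n) \<in> borel_measurable ?L" if "u \<in> L2 T" for u
      using that
      by (intro borel_measurable_continuous_on[OF linear_continuous_on[OF bounded_linear_Rep_ell2]]) (simp add: L2_def)
    show "weak_deriv T (V n) g"
    proof (rule weak_deriv_cong_AE[OF weak_deriv_bounded_linear[OF wd w w' bounded_linear_Rep_ell2]])
      show "AE t in ?L. Rep_ell2 (w t) n = V n t"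
        using W(2) by eventually_elim (simp add: V_def)
    qed (use w w' g V in \<open>auto intro: meas continuous_imp_measurable_on_sets_lebesgue\<close>)
  qed
  define D where "D n t = V n t - solution n t" for n t
  have D0: "D n t = 0" if t: "t \<in> {0..T}" for n t
  proof (rule difference_vanishes[OF _ _ _ _ _ t])
    show "continuous_on {0..T} (D n)" for n
      unfolding D_def[abs_def] by (intro continuous_intros V continuous_solution)
    show "D n 0 = 0" for n
      by (simp add: D_def V_def W solution_def zero_ell2.rep_eq)
    show "(D n has_vector_derivative - (2 ^ n * D n t) - coupling * wave n t * D 0 t) (at t)"
      if n: "0 < n" and t: "0 < t" "t < T" for n t
    proof -
      have "(V n has_vector_derivative (1 / 2) ^ n * wave n t / 8 - 2 ^ n * V n t - coupling * wave n t * V 0 t) (at t)"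
        using w'_comp by (intro V'[OF _ _ t] continuous_intros V) (auto simp: V_def n elim: eventually_mono)
      from has_vector_derivative_diff[OF this has_vector_derivative_solution[of n t]]
      have "(D n has_vector_derivative ((1 / 2) ^ n * wave n t / 8 - 2 ^ n * V n t - coupling * wave n t * V 0 t)
          - wave n t / 8 * ((1 / 2) ^ n + \<i> * t)) (at t)"
        using n by (simp add: D_def[abs_def])
      moreover have "((1 / 2) ^ n * wave n t / 8 - 2 ^ n * V n t - coupling * wave n t * V 0 t)
          - wave n t / 8 * ((1 / 2) ^ n + \<i> * t) = - (2 ^ n * D n t) - coupling * wave n t * D 0 t"
        (is "?l = ?r")
      proof -
        have "2 ^ n * solution n t = t / 8 * wave n t" using n by (simp add: solution_def power_one_over)
        \<comment> \<open>Here the value of the coupling constant enters.\<close>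
        moreover have "coupling * wave n t * solution 0 t = - (t / 8 * wave n t) - wave n t / 8 * (\<i> * t)"
          by (simp add: coupling_def solution_def field_simps)
        moreover have "?l - ?r = - (wave n t / 8 * (\<i> * t)) - 2 ^ n * solution n t - coupling * wave n t * solution 0 t"
          by (simp add: D_def algebra_simps)
        ultimately have "?l - ?r = 0" by simp
        then show ?thesis by simp
      qed
      ultimately show ?thesis by (simp only:)
    qed
    show "(D 0 has_vector_derivative - D 0 t - h t) (at t)"
      if h: "continuous_on {0..T} h" and sums: "\<And>s. s \<in> {0..T} \<Longrightarrow> (\<lambda>n. cnj coupling * cnj (wave n s) * D n s) sums h s"
        and t: "0 < t" "t < T" for h t
    proof -
      have "(V 0 has_vector_derivative 1 - D 0 t - h t) (at t)"
      proof (rule V'[OF _ _ t])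
        show "continuous_on {0..T} (\<lambda>t. 1 - D 0 t - h t)"
          unfolding D_def by (intro continuous_intros V continuous_solution h)
        have "AE t in ?L. t \<in> {0..T}" by (intro AE_I2) simp
        with w'_comp show "AE t in ?L. Rep_ell2 (w' t) 0 = 1 - D 0 t - h t"
        proof eventually_elim
          case (elim t)
          \<comment> \<open>The coupling series of \<open>V\<close> is summed in two ways, as
            solution plus difference and by the equation; comparison yields coordinate 0 of
            \<open>w'\<close>.\<close>
          have "(\<lambda>n. cnj coupling * cnj (wave n t) * V n t) sums (cnj coupling * t / 8 + h t)"
            using sums_add[OF solution_sums[of t] sums[OF elim(2)]] by (simp add: D_def algebra_simps)
          moreover have "(\<lambda>n. cnj coupling * cnj (wave n t) * V n t) sums
              (1 + t + cnj coupling * t / 8 - Rep_ell2 (w' t) 0 - V 0 t)"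
            unfolding V_def using elim(1) by (elim conjE)
          ultimately have "cnj coupling * t / 8 + h t = 1 + t + cnj coupling * t / 8 - Rep_ell2 (w' t) 0 - V 0 t"
            by (rule sums_unique2)
          then show ?case by (simp add: D_def solution_def algebra_simps)
        qed
      qed
      from has_vector_derivative_diff[OF this has_vector_derivative_solution[of 0 t]]
      show ?thesis by (simp add: D_def[abs_def] algebra_simps)
    qed
  qed (use T in simp)
  \<comment> \<open>At almost every t > 0 the vector \<open>w' t\<close> would have coordinates that
    are not square-summable. Hence {0<..T} would be a null set.\<close>
  have "AE t in ?L. t \<le> 0"
  proof -
    have "AE t in ?L. t \<in> {0..T}" by (intro AE_I2) simp
    with w'_comp show ?thesis
    proof eventually_elim
      case (elim t)
      have V_eq: "V n t = solution n t" for n using D0[OF elim(2), of n] by (simp add: D_def)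
      have "Rep_ell2 (w' t) n = wave n t / 8 * ((1 / 2) ^ n + \<i> * t)" if n: "0 < n" for n
      proof -
        have "Rep_ell2 (w' t) n = (1 / 2) ^ n * wave n t / 8 - 2 ^ n * Rep_ell2 (W t) n
            - coupling * wave n t * Rep_ell2 (W t) 0"
          using elim(1) n by blast
        also have "\<dots> = (1 / 2) ^ n * wave n t / 8 - 2 ^ n * solution n t - coupling * wave n t * solution 0 t"
          unfolding V_eq[unfolded V_def] ..
        also have "2 ^ n * solution n t = t / 8 * wave n t"
          using n by (simp add: solution_def power_one_over)
        also have "coupling * wave n t * solution 0 t = - (t / 8 * wave n t) - wave n t / 8 * (\<i> * t)"
          by (simp add: coupling_def solution_def field_simps)
        finally show ?thesis by (simp add: algebra_simps)
      qed
      then show "t \<le> 0"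
        using not_summable_derivative[of t "w' t"] by (meson not_le)
    qed
  qed
  then have null: "AE t in lebesgue. t \<in> {0..T} \<longrightarrow> t \<le> 0"
    by (simp add: AE_restrict_space_iff)
  have "{t \<in> space lebesgue. \<not> (t \<in> {0..T} \<longrightarrow> t \<le> 0)} = {0<..T}" by auto
  from AE_iff_measurable[OF _ this] null have "emeasure lebesgue {0<..T} = 0" by simp
  then show False using T by simp
qed

theorem theorem5p1:
  fixes T :: real
  assumes "0 < T"
  shows "\<exists>(j :: ell2 \<Rightarrow> ell2) (a :: real \<Rightarrow> ell2 \<Rightarrow> ell2 \<Rightarrow> complex).
    gelfand_triple j \<and> nonautonomous_form T a \<and> symmetric_form T a \<and>
    (\<exists>\<alpha> M. 0 < \<alpha> \<and> 0 < M \<and>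
       (\<forall>t\<in>{0..T}. \<forall>u v. cmod (a t u v) \<le> M * norm u * norm v) \<and>
       (\<forall>t\<in>{0..T}. \<forall>u. Re (a t u u) \<ge> \<alpha> * (norm u)\<^sup>2)) \<and>
    (\<exists>K\<ge>0. \<forall>t\<in>{0..T}. \<forall>s\<in>{0..T}. \<forall>u v.
       cmod (a t u v - a s u v) \<le> K * \<bar>t - s\<bar> powr (1/2) * norm u * norm v) \<and>
    (\<exists>f\<in>L2 T. \<not> maximal_regularity T j a (\<lambda>t. j (f t)) 0)"
proof (intro exI[of _ embedding] exI[of _ form] conjI)
  show "gelfand_triple embedding" by (rule gelfand_triple_embedding)
  show "nonautonomous_form T form" by (simp add: nonautonomous_form_def sesquilinear_form)
  show "symmetric_form T form" unfolding symmetric_form_def by (intro ballI allI form_commute)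
  show "\<exists>\<alpha> M. 0 < \<alpha> \<and> 0 < M \<and>
       (\<forall>t\<in>{0..T}. \<forall>u v. cmod (form t u v) \<le> M * norm u * norm v) \<and>
       (\<forall>t\<in>{0..T}. \<forall>u. Re (form t u u) \<ge> \<alpha> * (norm u)\<^sup>2)"
    using norm_form_le form_coercive by (intro exI[of _ "1 / 2"] exI[of _ 2]) auto
  show "\<exists>K\<ge>0. \<forall>t\<in>{0..T}. \<forall>s\<in>{0..T}. \<forall>u v.
       cmod (form t u v - form s u v) \<le> K * \<bar>t - s\<bar> powr (1/2) * norm u * norm v"
    using norm_form_diff_le by (intro exI[of _ 2]) auto
  show "\<exists>f\<in>L2 T. \<not> maximal_regularity T embedding form (\<lambda>t. embedding (f t)) 0"
    using no_MR2_solution[OF assms]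
    by (intro bexI[of _ forcing] continuous_imp_L2 continuous_forcing) (simp add: maximal_regularity_def)
qed

end
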